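(* For integers $n\ge 2$ and $H\ge 2$: $R_2(H)=\lfloor\sqrt H\rfloor$; there are constants $c_3,C_3>0$ with $c_3 H\log H\le R_3(H)\le C_3 H\log H$; and for $n\ge 4$ there are constants $c_n,C_n>0$ depending only on $n$ with $c_n H^{n-2}\le R_n(H)\le C_n H^{n-2}$.
   Context: A polynomial $f\in\mathbb{C}[X]$ is degenerate if it has two distinct roots whose quotient is a root of unity. $S_n(H)$ is the set of monic polynomials $X^n+a_1X^{n-1}+\dots+a_n\in\mathbb{Z}[X]$ that are degenerate with $|a_j|\le H$ for all $j$. A polynomial in $\mathbb{Z}[X]$ is called reducible if it is reducible in $\mathbb{Q}[X]$. $R_n(H)$ is the number of reducible polynomials in $S_n(H)$. *)

theory Defs
  imports Complex_Main "HOL-Computational_Algebra.Computational_Algebra"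
begin

(* A root of unity is a complex z with z ^ k = 1 for some k > 0.  Since a / 0 = 0 and 0 is not
   a root of unity, a pair of roots containing 0 never witnesses degeneracy. *)
definition degenerate :: "complex poly \<Rightarrow> bool" where
  "degenerate f \<longleftrightarrow>
     (\<exists>\<alpha> \<beta>. poly f \<alpha> = 0 \<and> poly f \<beta> = 0 \<and> \<alpha> \<noteq> \<beta> \<and> (\<exists>k>0. (\<alpha> / \<beta>) ^ k = 1))"

definition reducible_over_Q :: "int poly \<Rightarrow> bool" where
  "reducible_over_Q f \<longleftrightarrow>
     (let g = map_poly rat_of_int f in g \<noteq> 0 \<and> \<not> g dvd 1 \<and> \<not> irreducible g)"

(* The coefficient a_j of X^n + a_1 X^(n-1) + ... + a_n is coeff f (n - j). *)
definition S :: "nat \<Rightarrow> nat \<Rightarrow> int poly set" where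
  "S n H = {f. degree f = n \<and> lead_coeff f = 1 \<and>
               (\<forall>j\<in>{1..n}. \<bar>coeff f (n - j)\<bar> \<le> int H) \<and>
               degenerate (map_poly of_int f)}"

definition R :: "nat \<Rightarrow> nat \<Rightarrow> nat" where
  "R n H = card {f \<in> S n H. reducible_over_Q f}"

end

(* The lower bounds come from (X - a) (X^2 + c) and (X^2 + 1) g. The upper bounds hold for all
   degenerate polynomials f of degree n >= 3, reducible or not. The ratio of two roots a, b of f has
   degree at most n^2 over Q, so its order divides some N = N(n). Write f = G h, where G generates the
   rational polynomials vanishing at a and b, and let D be its degree. Heights are controlled by the
   Mahler measure, which is multiplicative, so there are O(H^(n-D)) choices for h. It remains to see
   that there are O(H^(D-2)) pairs (a, b) if D >= 3. If a and b are not conjugate, the one of smaller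
   degree e <= D - 2 is a root of one of O(H^e) polynomials. If they are conjugate, group the D
   conjugates z of a by the value of z^N. The classes have the same size s >= 2, and the sum t of the
   k-th powers over the class of a is an algebraic integer of degree at most D / s whose minimal
   polynomial has Mahler measure O(H); for some k <= s it is nonzero, and then it determines a up to
   boundedly many choices. Hence there are O(H^(D/2)) such a, and D / 2 rounded down is at most D - 2.
   If D = 2, the integer c = a b leaves boundedly many pairs and O((H / |c|)^(n-2)) choices for h, and
   the sum over 0 < |c| <= O(H) is O(H^(n-2)) for n >= 4, but O(H log H) for n = 3. *)

theory Submission
  imports Defs "Berlekamp_Zassenhaus.Factor_Bound" "Jordan_Normal_Form.Char_Poly"
begin

section \<open>Minimal polynomials of algebraic integers\<close>

text \<open>No Galois group appears. A relation between conjugates is stated as the vanishing of a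
  rational polynomial at \<alpha>, and \<open>minpoly_root_transfer\<close> carries it to every
  conjugate; this is why class sizes and class power sums are first exhibited as values of one
  rational polynomial. Symmetric functions are handled through power sums and Newton's identities in
  both directions. The obstacle in the conjugate case is height. The number
  \<open>\<alpha> ^ N\<close> is also constant on classes and has degree D / s, but its minimal
  polynomial has Mahler measure M^(N / s), where M belongs to the minimal polynomial of \<alpha>,
  and N may far exceed s. A sum of k-th powers over a class, with k at most s, costs only a constant
  factor: the s members share one absolute value m, so the sum is at most s max(1, m)^s, and max(1,
  m)^s is exactly the share of the class in M. For the way back, the members are \<alpha> times N-th
  roots of unity, so the sum is \<open>\<alpha> ^ k\<close> times one of finitely many
  constants.\<close>

abbreviation rp :: "rat poly \<Rightarrow> complex poly" where "rp \<equiv> map_poly of_rat"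
abbreviation ir :: "int poly \<Rightarrow> rat poly" where "ir \<equiv> map_poly of_int"
abbreviation ic :: "int poly \<Rightarrow> complex poly" where "ic \<equiv> map_poly of_int"

interpretation of_rat_poly_hom: map_poly_inj_idom_hom "of_rat :: rat \<Rightarrow> complex"
  ..

lemma rp_ir [simp]: "rp (ir p) = ic p"
  by (simp add: map_poly_map_poly o_def)

text \<open>Integer coefficients serve the counting by Mahler measure, irreducibility over the
  rationals serves the divisibility arguments; one polynomial can do both because only algebraic
  integers occur.\<close>

definition minpoly_of :: "complex \<Rightarrow> int poly \<Rightarrow> bool" where
  "minpoly_of x g \<longleftrightarrow> lead_coeff g = 1 \<and> poly (ic g) x = 0 \<and> irreducible (ir g)"

text \<open>Otherwise the two polynomials are coprime, and a Bezout identity evaluated at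
  \<open>x\<close> reads 0 = 1.\<close>

lemma irreducible_dvd_of_common_root:
  assumes irr: "irreducible p" and p: "poly (rp p) x = 0" and q: "poly (rp q) x = 0"
  shows "p dvd q"
proof (rule ccontr)
  assume "\<not> p dvd q"
  then have "Rings.coprime p q" using irr by (simp add: field_poly_irreducible_imp_prime prime_elem_imp_coprime)
  then have "gcd p q = 1" by simp
  then obtain a b where "a * p + b * q = 1"
    using bezout_coefficients_fst_snd[of p q] by metis
  then have "rp (a * p + b * q) = 1" by simp
  then have "poly (rp a * rp p + rp b * rp q) x = 1"
    by (simp add: of_rat_poly_hom.hom_add of_rat_poly_hom.hom_mult)
  then show False using p q by simp
qed

text \<open>A monic integer polynomial of least degree vanishing at \<open>x\<close> works: by
  Gauss's lemma a rational factorisation yields an integral one, and one of its factors would be a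
  smaller candidate.\<close>

lemma minpoly_exists:
  assumes "algebraic_int x"
  obtains g where "minpoly_of x g"
proof -
  define P where "P = (\<lambda>n. \<exists>g :: int poly. degree g = n \<and> lead_coeff g = 1 \<and> poly (ic g) x = 0)"
  obtain g0 :: "int poly" where "poly (ic g0) x = 0" "lead_coeff g0 = 1"
    using assms by (auto simp: algebraic_int_altdef_ipoly)
  then have "P (degree g0)" by (auto simp: P_def)
  then have "P (LEAST n. P n)" by (rule LeastI)
  then obtain g where g: "degree g = (LEAST n. P n)" "lead_coeff g = 1" "poly (ic g) x = 0"
    by (auto simp: P_def)
  have deg0: "degree g \<noteq> 0"
  proof
    assume "degree g = 0"
    then obtain c where "g = [:c:]" by (metis degree_eq_zeroE)
    with g show False by simp
  qed
  have "irreducible (ir g)"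
  proof (rule ccontr)
    assume "\<not> irreducible (ir g)"
    moreover have "degree (ir g) > 0" using deg0 by simp
    ultimately obtain a b where ab: "ir g = a * b" "degree a < degree g" "degree b < degree g"
      unfolding irreducible_connect_field[symmetric] irreducible\<^sub>d_def by auto
    from rat_to_int_factor[OF ab(1)] obtain a' b' where ab': "g = a' * b'" "degree a' = degree a" "degree b' = degree b"
      by auto
    have lc: "lead_coeff a' * lead_coeff b' = 1" using g(2) ab'(1) by (simp add: lead_coeff_mult)
    \<comment> \<open>The leading coefficients of the factors multiply to 1, so both equal the same
      sign \<open>u\<close>, and scaling by \<open>u\<close> makes either factor monic.\<close>
    define u where "u = lead_coeff a'"
    have u: "u * u = 1" "lead_coeff b' = u" using lc zmult_eq_1_iff unfolding u_def by force+
    have "poly (ic a') x = 0 \<or> poly (ic b') x = 0" using g(3) ab'(1)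
      by (simp add: of_int_poly_hom.hom_mult)
    then have "P (degree a') \<or> P (degree b')"
    proof
      assume "poly (ic a') x = 0"
      then have "poly (ic (Polynomial.smult u a')) x = 0" "lead_coeff (Polynomial.smult u a') = 1" "degree (Polynomial.smult u a') = degree a'"
        using u by (auto simp: u_def of_int_hom.map_poly_hom_smult)
      then show ?thesis unfolding P_def by blast
    next
      assume "poly (ic b') x = 0"
      then have "poly (ic (Polynomial.smult u b')) x = 0" "lead_coeff (Polynomial.smult u b') = 1" "degree (Polynomial.smult u b') = degree b'"
        using u by (auto simp: of_int_hom.map_poly_hom_smult)
      then show ?thesis unfolding P_def by blast
    qed
    then show False using ab ab' g(1) not_less_Least[of _ P] by metis
  qed
  with g have "minpoly_of x g" unfolding minpoly_of_def by blast
  then show ?thesis by (rule that)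
qed

lemma minpoly_dvd:
  assumes "minpoly_of x g" "poly (rp q) x = 0"
  shows "ir g dvd q"
  using assms irreducible_dvd_of_common_root[of "ir g" x q] by (simp add: minpoly_of_def)

lemma minpoly_root_transfer:
  assumes "minpoly_of x g" "poly (rp q) x = 0" "poly (ic g) y = 0"
  shows "poly (rp q) y = 0"
proof -
  from minpoly_dvd[OF assms(1,2)] obtain h where "q = ir g * h" by (auto simp: dvd_def)
  then have "rp q = ic g * rp h" by (simp add: of_rat_poly_hom.hom_mult)
  then show ?thesis using assms(3) by simp
qed

text \<open>A Bezout identity with \<open>ir g\<close> yields a single \<open>v\<close> that inverts
  \<open>q\<close> at all conjugates, so division stays within rational polynomials in the
  conjugate.\<close>

lemma minpoly_inverse:
  assumes "minpoly_of x g" "poly (rp q) x \<noteq> 0"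
  shows "\<exists>v. \<forall>y. poly (ic g) y = 0 \<longrightarrow> poly (rp v) y * poly (rp q) y = 1"
proof -
  have irr: "irreducible (ir g)" and gx: "poly (ic g) x = 0" using assms by (auto simp: minpoly_of_def)
  have "\<not> ir g dvd q"
  proof
    assume "ir g dvd q"
    then obtain h where "q = ir g * h" by (auto simp: dvd_def)
    then have "rp q = ic g * rp h" by (simp add: of_rat_poly_hom.hom_mult)
    then show False using assms(2) gx by simp
  qed
  then have "Rings.coprime (ir g) q" using irr by (simp add: field_poly_irreducible_imp_prime prime_elem_imp_coprime)
  then obtain a b where "a * ir g + b * q = 1"
    using bezout_coefficients_fst_snd[of "ir g" q] by (metis coprime_iff_gcd_eq_1)
  then have "rp (a * ir g + b * q) = 1" by simp
  then have e: "rp a * ic g + rp b * rp q = 1"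
    by (simp add: of_rat_poly_hom.hom_add of_rat_poly_hom.hom_mult)
  have "poly (rp b) y * poly (rp q) y = 1" if "poly (ic g) y = 0" for y
    using arg_cong[OF e, of "\<lambda>p. poly p y"] that by simp
  then show ?thesis by blast
qed

lemma minpoly_degree_pos: "minpoly_of x g \<Longrightarrow> degree g > 0"
  by (rule ccontr) (auto simp: minpoly_of_def elim!: degree_eq_zeroE)

lemma minpoly_pderiv_nonzero:
  assumes "minpoly_of x g"
  shows "poly (rp (pderiv (ir g))) x \<noteq> 0"
proof
  assume "poly (rp (pderiv (ir g))) x = 0"
  from minpoly_dvd[OF assms this] have "ir g dvd pderiv (ir g)" .
  moreover have "pderiv (ir g) \<noteq> 0" using minpoly_degree_pos[OF assms] by (simp add: pderiv_eq_0_iff)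
  ultimately have "degree (ir g) \<le> degree (pderiv (ir g))" by (rule dvd_imp_degree_le)
  then show False using minpoly_degree_pos[OF assms] by (simp add: degree_pderiv)
qed

lemma minpoly_simple_root:
  assumes "minpoly_of x g" "poly (ic g) y = 0"
  shows "poly (pderiv (ic g)) y \<noteq> 0"
proof -
  have "rp (pderiv (ir g)) = pderiv (ic g)"
    by (metis of_rat_hom.map_poly_pderiv rp_ir)
  with minpoly_inverse[OF assms(1) minpoly_pderiv_nonzero[OF assms(1)]] assms(2) show ?thesis
    by (metis mult_zero_right zero_neq_one)
qed

lemma monic_eq_prod_roots:
  fixes p :: "complex poly"
  assumes "lead_coeff p = 1" "\<And>y. poly p y = 0 \<Longrightarrow> poly (pderiv p) y \<noteq> 0"
  shows "p = (\<Prod>z\<in>{z. poly p z = 0}. [:-z, 1:])"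
proof -
  have "rsquarefree p" using assms by (metis rsquarefree_roots)
  then show ?thesis
    using complex_poly_decompose_rsquarefree[of p] assms(1) by simp
qed

lemma minpoly_eq_prod_roots:
  assumes "minpoly_of x g"
  shows "ic g = (\<Prod>z\<in>{z. poly (ic g) z = 0}. [:-z, 1:])"
  using assms minpoly_simple_root[OF assms] by (intro monic_eq_prod_roots) (auto simp: minpoly_of_def)

lemma minpoly_roots_finite: "minpoly_of x g \<Longrightarrow> finite {z. poly (ic g) z = 0}"
  by (rule poly_roots_finite) (auto simp: minpoly_of_def)

lemma minpoly_card_roots:
  assumes "minpoly_of x g"
  shows "card {z. poly (ic g) z = 0} = degree g"
proof -
  have "degree g = degree (ic g)" by simp
  also have "\<dots> = degree (\<Prod>z\<in>{z. poly (ic g) z = 0}. [:-z, 1:])"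
    using minpoly_eq_prod_roots[OF assms] by simp
  also have "\<dots> = (\<Sum>z\<in>{z. poly (ic g) z = 0}. degree [:-z, 1:])"
    by (rule degree_prod_eq_sum_degree) auto
  finally show ?thesis by simp
qed

lemma minpoly_unique:
  assumes "minpoly_of x g" "minpoly_of x h"
  shows "g = h"
proof -
  have "ir g dvd ir h" "ir h dvd ir g" using assms minpoly_dvd[of x] by (auto simp: minpoly_of_def)
  moreover have "lead_coeff (ir g) = 1" "lead_coeff (ir h) = 1" using assms by (auto simp: minpoly_of_def)
  ultimately have "ir g = ir h" by (metis poly_dvd_antisym)
  then show ?thesis by simp
qed

lemma minpoly_conjugate:
  assumes "minpoly_of x g" "poly (ic g) y = 0" shows "minpoly_of y g"
  using assms by (simp add: minpoly_of_def)

text \<open>Pseudo-division by a monic polynomial is ordinary division over the integers; the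
  remainder vanishes at \<open>x\<close> and its degree is too small unless it is 0.\<close>

lemma minpoly_dvd_int:
  assumes "minpoly_of x g" "poly (ic f) x = 0"
  shows "g dvd f"
proof -
  have lc: "lead_coeff g = 1" and g0: "g \<noteq> 0" using assms by (auto simp: minpoly_of_def)
  obtain q r where qr: "pseudo_divmod f g = (q, r)" by force
  from pseudo_divmod[OF g0 qr] lc have f: "f = g * q + r" and r: "r = 0 \<or> degree r < degree g" by auto
  have "ic f = ic g * ic q + ic r" by (simp add: f of_int_poly_hom.hom_add of_int_poly_hom.hom_mult)
  then have "poly (ic r) x = 0" using assms by (simp add: minpoly_of_def)
  then have "ir g dvd ir r" using minpoly_dvd[OF assms(1), of "ir r"] by simp
  then have "r = 0" using r dvd_imp_degree_le[of "ir g" "ir r"] by fastforce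
  then show ?thesis using f by simp
qed

section \<open>Newton's identities and rationality\<close>

definition rational_coeffs :: "complex poly \<Rightarrow> bool" where "rational_coeffs p \<longleftrightarrow> (\<forall>k. poly.coeff p k \<in> \<rat>)"

lemma rational_coeffs_ic [simp]: "rational_coeffs (ic q)"
  by (simp add: rational_coeffs_def)

lemma rational_coeffsE:
  assumes "rational_coeffs p" obtains q where "p = rp q"
proof -
  define q where "q = map_poly (inv_into UNIV of_rat) p"
  have "rp q = map_poly (of_rat \<circ> inv_into UNIV of_rat) p"
    unfolding q_def by (intro map_poly_map_poly) (simp add: inv_into_f_eq inj_def)
  also have "\<dots> = p"
  proof (rule poly_eqI)
    fix k
    have "of_rat (inv_into UNIV of_rat (poly.coeff p k)) = poly.coeff p k"
      using assms by (intro f_inv_into_f) (simp add: rational_coeffs_def Rats_def)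
    moreover have "(of_rat \<circ> inv_into UNIV of_rat) (0::complex) = (0::complex)"
      by (metis comp_apply f_inv_into_f of_rat_0 rangeI)
    ultimately show "poly.coeff (map_poly (of_rat \<circ> inv_into UNIV of_rat) p) k = poly.coeff p k"
      by (subst coeff_map_poly) auto
  qed
  finally show ?thesis using that by metis
qed

text \<open>The logarithmic derivative of one factor is minus the geometric series with terms
  \<open>f i ^ Suc k\<close>; the product rule adds these up.\<close>

lemma logderiv_prod_fps:
  fixes f :: "'i \<Rightarrow> complex"
  assumes "finite I"
  shows "fps_deriv (\<Prod>i\<in>I. 1 - fps_const (f i) * fps_X)
    = - ((\<Prod>i\<in>I. 1 - fps_const (f i) * fps_X) * Abs_fps (\<lambda>k. \<Sum>i\<in>I. f i ^ Suc k))"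
  using assms
proof (induction I)
  case empty
  show ?case by (simp add: fps_eq_iff)
next
  case (insert a I)
  define A where "A = (\<Prod>i\<in>I. 1 - fps_const (f i) * fps_X)"
  define G where "G = Abs_fps (\<lambda>k. f a ^ Suc k)"
  define P where "P = Abs_fps (\<lambda>k. \<Sum>i\<in>I. f i ^ Suc k)"
  have geo: "(1 - fps_const (f a) * fps_X) * G = fps_const (f a)"
  proof (rule fps_ext)
    fix n show "fps_nth ((1 - fps_const (f a) * fps_X) * G) n = fps_nth (fps_const (f a)) n"
      by (cases n) (simp_all add: G_def algebra_simps)
  qed
  have sum: "Abs_fps (\<lambda>k. \<Sum>i\<in>insert a I. f i ^ Suc k) = G + P"
    using insert by (simp add: fps_eq_iff G_def P_def)
  have "(\<Prod>i\<in>insert a I. 1 - fps_const (f i) * fps_X) = (1 - fps_const (f a) * fps_X) * A"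
    using insert by (simp add: A_def)
  then have "fps_deriv (\<Prod>i\<in>insert a I. 1 - fps_const (f i) * fps_X)
      = fps_deriv (1 - fps_const (f a) * fps_X) * A + (1 - fps_const (f a) * fps_X) * fps_deriv A"
    by (metis fps_deriv_mult add.commute)
  also have "fps_deriv (1 - fps_const (f a) * fps_X) = - fps_const (f a)" by simp
  also have "fps_deriv A = - (A * P)" using insert.IH unfolding A_def P_def .
  also have "- fps_const (f a) * A + (1 - fps_const (f a) * fps_X) * - (A * P)
      = - (fps_const (f a) * A) + (1 - fps_const (f a) * fps_X) * - (A * P)"
    by (simp only: mult_minus_left)
  also have "\<dots> = - ((1 - fps_const (f a) * fps_X) * G * A) + (1 - fps_const (f a) * fps_X) * - (A * P)"
    unfolding geo ..
  also have "\<dots> = - ((1 - fps_const (f a) * fps_X) * A * (G + P))"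
    by (simp add: algebra_simps)
  finally show ?case using insert unfolding sum by (simp add: A_def)
qed

text \<open>Newton's identities for the elementary symmetric functions of a finite family, which are read
  off the reversed polynomial so that the index does not depend on the size of the family.\<close>

definition elem_sym :: "'i set \<Rightarrow> ('i \<Rightarrow> complex) \<Rightarrow> nat \<Rightarrow> complex" where
  "elem_sym I f k = poly.coeff (\<Prod>i\<in>I. [:1, - f i:]) k"

text \<open>Compare coefficients in the logarithmic derivative. The sign (-1)^k is part of
  \<open>elem_sym\<close>, hence no alternating signs.\<close>

lemma newton_identity:
  assumes "finite I"
  shows "of_nat (Suc n) * elem_sym I f (Suc n) = - (\<Sum>j\<le>n. elem_sym I f j * (\<Sum>i\<in>I. f i ^ Suc (n - j)))"
proof -
  define A where "A = (\<Prod>i\<in>I. 1 - fps_const (f i) * fps_X)"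
  have "fps_of_poly (\<Prod>i\<in>I. [:1, - f i:]) = A"
    unfolding A_def fps_of_poly_prod
    by (intro prod.cong refl) (simp add: fps_of_poly_pCons mult.commute flip: fps_const_neg)
  then have A: "fps_nth A k = elem_sym I f k" for k
    by (metis elem_sym_def fps_of_poly_nth)
  have "of_nat (Suc n) * elem_sym I f (Suc n) = fps_nth (fps_deriv A) n"
    by (simp add: A)
  also have "\<dots> = - (\<Sum>j\<le>n. elem_sym I f j * (\<Sum>i\<in>I. f i ^ Suc (n - j)))"
    using logderiv_prod_fps[OF assms, of f] unfolding A_def[symmetric]
    by (simp add: fps_mult_nth A atMost_atLeast0 del: power_Suc)
  finally show ?thesis .
qed

lemma elem_sym_0 [simp]: "elem_sym I f 0 = 1"
  by (simp add: elem_sym_def poly_prod flip: poly_0_coeff_0)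

lemma reflect_prod_linear:
  "reflect_poly (\<Prod>i\<in>I. [:- f i, 1:]) = (\<Prod>i\<in>I. [:1, - f i :: complex:])"
  unfolding reflect_poly_prod
proof (intro prod.cong refl)
  fix i show "reflect_poly [:- f i, 1:] = [:1, - f i:]"
    by (cases "f i = 0") (auto simp: reflect_poly_def cCons_def)
qed

lemma degree_prod_linear: "degree (\<Prod>i\<in>I. [:- f i, 1 :: complex:]) = card I"
  by (cases "finite I") (auto simp: degree_prod_eq_sum_degree)

lemma lead_coeff_prod_linear: "lead_coeff (\<Prod>i\<in>I. [:- f i, 1 :: complex:]) = 1"
  by (simp add: lead_coeff_prod)

lemma elem_sym_coeff:
  "elem_sym I f k = (if k \<le> card I then poly.coeff (\<Prod>i\<in>I. [:- f i, 1:]) (card I - k) else 0)"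
  unfolding elem_sym_def reflect_prod_linear[symmetric] coeff_reflect_poly degree_prod_linear by auto

lemma rational_coeffs_prod_iff: "rational_coeffs (\<Prod>i\<in>I. [:- f i, 1:]) \<longleftrightarrow> (\<forall>k. elem_sym I f k \<in> \<rat>)"
proof
  assume "rational_coeffs (\<Prod>i\<in>I. [:- f i, 1:])" then show "\<forall>k. elem_sym I f k \<in> \<rat>"
    by (auto simp: elem_sym_coeff rational_coeffs_def)
next
  assume e: "\<forall>k. elem_sym I f k \<in> \<rat>"
  show "rational_coeffs (\<Prod>i\<in>I. [:- f i, 1:])"
    unfolding rational_coeffs_def
  proof
    fix k show "poly.coeff (\<Prod>i\<in>I. [:- f i, 1:]) k \<in> \<rat>"
    proof (cases "k \<le> card I")
      case True
      then show ?thesis using e[rule_format, of "card I - k"] by (simp add: elem_sym_coeff)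
    next
      case False
      then show ?thesis using coeff_eq_0[of "\<Prod>i\<in>I. [:- f i, 1:]" k] degree_prod_linear[of f I] by auto
    qed
  qed
qed

lemma power_sums_rational:
  assumes "finite I" "rational_coeffs (\<Prod>i\<in>I. [:- f i, 1:])"
  shows "(\<Sum>i\<in>I. f i ^ k) \<in> \<rat>"
proof (induction k rule: less_induct)
  case (less k)
  show ?case
  proof (cases k)
    case 0
    then show ?thesis by simp
  next
    case (Suc n)
    have e: "elem_sym I f j \<in> \<rat>" for j using assms rational_coeffs_prod_iff by blast
    \<comment> \<open>The term \<open>j = 0\<close> is the new power sum, with coefficient 1; the
      other terms contain lower power sums, rational by induction.\<close>
    have split: "(\<Sum>j\<le>n. elem_sym I f j * (\<Sum>i\<in>I. f i ^ Suc (n - j)))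
        = (\<Sum>i\<in>I. f i ^ Suc n) + (\<Sum>j\<in>{1..n}. elem_sym I f j * (\<Sum>i\<in>I. f i ^ Suc (n - j)))"
      by (subst sum.remove[of _ 0]) (auto intro!: sum.cong simp: atMost_def)
    have "(\<Sum>i\<in>I. f i ^ Suc n) = - (of_nat (Suc n) * elem_sym I f (Suc n))
       - (\<Sum>j\<in>{1..n}. elem_sym I f j * (\<Sum>i\<in>I. f i ^ Suc (n - j)))"
      using newton_identity[OF assms(1), of n f] unfolding split by (simp only: minus_add_distrib minus_minus) (simp only: algebra_simps)
    also have "\<dots> \<in> \<rat>"
    proof -
      have "elem_sym I f j * (\<Sum>i\<in>I. f i ^ Suc (n - j)) \<in> \<rat>" if "j \<in> {1..n}" for j
        using less[of "Suc (n - j)"] that Suc e by (intro Rats_mult) auto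
      then have "(\<Sum>j\<in>{1..n}. elem_sym I f j * (\<Sum>i\<in>I. f i ^ Suc (n - j))) \<in> \<rat>"
        by (rule Rats_sum)
      then show ?thesis using e by (intro Rats_diff Rats_minus_iff[THEN iffD2] Rats_mult Rats_of_nat)
    qed
    finally show ?thesis using Suc by simp
  qed
qed

text \<open>Newton's identities solved for the next coefficient, which divides by
  \<open>Suc n\<close>. This works over the rationals but not over the integers, so integrality is
  obtained separately, from stable lattices.\<close>

lemma rational_coeffs_of_power_sums:
  assumes "finite I" "\<And>k. k > 0 \<Longrightarrow> (\<Sum>i\<in>I. f i ^ k) \<in> \<rat>"
  shows "rational_coeffs (\<Prod>i\<in>I. [:- f i, 1:])"
proof -
  have "elem_sym I f k \<in> \<rat>" for k
  proof (induction k rule: less_induct)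
    case (less k)
    show ?case
    proof (cases k)
      case 0
      then show ?thesis by simp
    next
      case (Suc n)
      have "(\<Sum>j\<le>n. elem_sym I f j * (\<Sum>i\<in>I. f i ^ Suc (n - j))) \<in> \<rat>"
      proof (rule Rats_sum)
        fix j assume "j \<in> {..n}"
        then show "elem_sym I f j * (\<Sum>i\<in>I. f i ^ Suc (n - j)) \<in> \<rat>"
          using less[of j] Suc assms(2)[of "Suc (n - j)"] by (intro Rats_mult) auto
      qed
      then have "(- (\<Sum>j\<le>n. elem_sym I f j * (\<Sum>i\<in>I. f i ^ Suc (n - j)))) / of_nat (Suc n) \<in> \<rat>"
        by (intro Rats_divide Rats_minus_iff[THEN iffD2] Rats_of_nat)
      also have "(- (\<Sum>j\<le>n. elem_sym I f j * (\<Sum>i\<in>I. f i ^ Suc (n - j)))) / of_nat (Suc n) = elem_sym I f (Suc n)"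
        unfolding newton_identity[OF assms(1), symmetric] by (simp del: of_nat_Suc)
      finally show ?thesis using Suc by simp
    qed
  qed
  then show ?thesis using rational_coeffs_prod_iff by blast
qed

lemma power_sums_zero_imp_elem_zero:
  assumes "finite I" "\<And>k. 0 < k \<Longrightarrow> k \<le> n \<Longrightarrow> (\<Sum>i\<in>I. f i ^ k) = 0" "n > 0"
  shows "elem_sym I f n = 0"
proof -
  obtain m where m: "n = Suc m" using assms(3) gr0_implies_Suc by blast
  have "(\<Sum>j\<le>m. elem_sym I f j * (\<Sum>i\<in>I. f i ^ Suc (m - j))) = 0"
  proof (intro sum.neutral ballI)
    fix j assume "j \<in> {..m}"
    then show "elem_sym I f j * (\<Sum>i\<in>I. f i ^ Suc (m - j)) = 0"
      using m assms(2)[of "Suc (m - j)"] by auto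
  qed
  then have "of_nat (Suc m) * elem_sym I f (Suc m) = 0"
    using newton_identity[OF assms(1), of m f] by simp
  then show ?thesis using m by (simp del: of_nat_Suc)
qed

text \<open>If the first \<open>card I\<close> power sums all vanished, so would the elementary
  symmetric function of index \<open>card I\<close>, which is up to sign the product of the
  \<open>f i\<close>.\<close>

lemma exists_nonzero_power_sum:
  assumes "finite I" "I \<noteq> {}" "\<And>i. i \<in> I \<Longrightarrow> f i \<noteq> (0::complex)"
  obtains k where "0 < k" "k \<le> card I" "(\<Sum>i\<in>I. f i ^ k) \<noteq> 0"
proof -
  have "elem_sym I f (card I) = poly (\<Prod>i\<in>I. [:- f i, 1:]) 0"
    by (simp add: elem_sym_coeff poly_0_coeff_0)
  also have "\<dots> = (\<Prod>i\<in>I. - f i)" by (simp add: poly_prod)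
  also have "\<dots> \<noteq> 0" using assms by simp
  finally have "elem_sym I f (card I) \<noteq> 0" .
  moreover have "card I > 0" using assms by (simp add: card_gt_0_iff)
  ultimately show ?thesis using power_sums_zero_imp_elem_zero[OF assms(1), of "card I" f] that by blast
qed

lemma poly_rp_sum_rational:
  assumes "\<And>k. (\<Sum>i\<in>I. f i ^ k) \<in> \<rat>"
  shows "(\<Sum>i\<in>I. poly (rp q) (f i)) \<in> \<rat>"
proof -
  have "(\<Sum>i\<in>I. poly (rp q) (f i)) = (\<Sum>j\<le>degree q. of_rat (poly.coeff q j) * (\<Sum>i\<in>I. f i ^ j))"
    unfolding poly_altdef by (simp add: sum_distrib_left) (rule sum.swap)
  also have "\<dots> \<in> \<rat>" using assms by (intro Rats_sum[OF Rats_mult] Rats_of_rat)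
  finally show ?thesis .
qed

text \<open>Power sums of the new values are rational combinations of power sums of the
  \<open>f i\<close>; this takes the place of the fundamental theorem on symmetric
  polynomials.\<close>

lemma rational_coeffs_prod_image:
  assumes "finite I" "rational_coeffs (\<Prod>i\<in>I. [:- f i, 1:])"
  shows "rational_coeffs (\<Prod>i\<in>I. [:- poly (rp q) (f i), 1:])"
proof (rule rational_coeffs_of_power_sums[OF assms(1)])
  fix k
  have "(\<Sum>i\<in>I. poly (rp (q ^ k)) (f i)) \<in> \<rat>"
    by (intro poly_rp_sum_rational power_sums_rational assms)
  then show "(\<Sum>i\<in>I. poly (rp q) (f i) ^ k) \<in> \<rat>"
    by (simp add: of_rat_poly_hom.hom_power)
qed

section \<open>Algebraic integers form a ring\<close>

definition zspan :: "complex set \<Rightarrow> complex set" where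
  "zspan B = range (\<lambda>c. \<Sum>b\<in>B. of_int (c b) * b)"

lemma zspan_base: "finite B \<Longrightarrow> b \<in> B \<Longrightarrow> b \<in> zspan B"
  unfolding zspan_def
proof (rule image_eqI[where x = "\<lambda>b'. if b' = b then 1 else 0"])
  assume "finite B" "b \<in> B"
  then show "b = (\<Sum>b'\<in>B. of_int (if b' = b then 1 else 0) * b')"
    by (simp add: if_distrib[of "\<lambda>c. of_int c * _"] cong: if_cong)
qed simp

lemma zspan_add: "x \<in> zspan B \<Longrightarrow> y \<in> zspan B \<Longrightarrow> x + y \<in> zspan B"
proof -
  assume "x \<in> zspan B" "y \<in> zspan B"
  then obtain c d where "x = (\<Sum>b\<in>B. of_int (c b) * b)" "y = (\<Sum>b\<in>B. of_int (d b) * b)"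
    by (auto simp: zspan_def)
  then have "x + y = (\<Sum>b\<in>B. of_int (c b + d b) * b)"
    by (simp add: sum.distrib distrib_right)
  then show ?thesis unfolding zspan_def by (rule range_eqI[where x = "\<lambda>b. c b + d b"])
qed

lemma zspan_int_mult: "x \<in> zspan B \<Longrightarrow> of_int n * x \<in> zspan B"
proof -
  assume "x \<in> zspan B"
  then obtain c where "x = (\<Sum>b\<in>B. of_int (c b) * b)" by (auto simp: zspan_def)
  then have "of_int n * x = (\<Sum>b\<in>B. of_int (n * c b) * b)"
    by (simp add: sum_distrib_left mult.assoc)
  then show ?thesis unfolding zspan_def by (rule range_eqI[where x = "\<lambda>b. n * c b"])
qed

lemma zspan_sum: "(\<And>i. i \<in> I \<Longrightarrow> f i \<in> zspan B) \<Longrightarrow> sum f I \<in> zspan B"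
proof (induction I rule: infinite_finite_induct)
  case (insert i I)
  then show ?case by (simp add: zspan_add)
qed (use zspan_int_mult[of _ B 0] in \<open>auto simp: zspan_def intro!: image_eqI[where x = "\<lambda>_. 0"]\<close>)

lemma zspan_mult_closed:
  assumes "\<And>b. b \<in> B \<Longrightarrow> a * b \<in> zspan B" "x \<in> zspan B"
  shows "a * x \<in> zspan B"
proof -
  obtain c where x: "x = (\<Sum>b\<in>B. of_int (c b) * b)" using assms(2) by (auto simp: zspan_def)
  have "a * x = (\<Sum>b\<in>B. of_int (c b) * (a * b))" by (simp add: x sum_distrib_left algebra_simps)
  also have "\<dots> \<in> zspan B" using assms(1) by (intro zspan_sum zspan_int_mult)
  finally show ?thesis .
qed

text \<open>The determinant trick: multiplication by \<open>x\<close> acts on \<open>B\<close>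
  through an integer matrix \<open>A\<close>, and the vector of elements of \<open>B\<close> is an
  eigenvector, nonzero because of \<open>b0\<close>. So \<open>x\<close> is a root of the monic
  polynomial \<open>char_poly A\<close>.\<close>

lemma algebraic_int_if_stable_span:
  assumes fin: "finite B" and b0: "b0 \<in> B" "b0 \<noteq> 0" and st: "\<And>b. b \<in> B \<Longrightarrow> x * b \<in> zspan B"
  shows "algebraic_int x"
proof -
  define n where "n = card B"
  obtain e where e: "bij_betw e {0..<n} B"
    using ex_bij_betw_nat_finite[OF fin] unfolding n_def by blast
  have "\<forall>b\<in>B. \<exists>c :: complex \<Rightarrow> int. x * b = (\<Sum>b'\<in>B. of_int (c b') * b')"
    using st by (auto simp: zspan_def image_def)
  then obtain c :: "complex \<Rightarrow> complex \<Rightarrow> int"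
    where c: "\<And>b. b \<in> B \<Longrightarrow> x * b = (\<Sum>b'\<in>B. of_int (c b b') * b')" by metis
  define A :: "int mat" where "A = mat n n (\<lambda>(i, j). c (e i) (e j))"
  define Ac :: "complex mat" where "Ac = of_int_hom.mat_hom A"
  define v :: "complex vec" where "v = vec n e"
  have A: "A \<in> carrier_mat n n" by (simp add: A_def)
  then have Ac: "Ac \<in> carrier_mat n n" by (simp add: Ac_def)
  have "Ac *\<^sub>v v = x \<cdot>\<^sub>v v"
  proof (rule eq_vecI)
    fix i assume "i < dim_vec (x \<cdot>\<^sub>v v)"
    then have i: "i < n" by (simp add: v_def)
    then have ei: "e i \<in> B" using e by (auto simp: bij_betw_def)
    have "(Ac *\<^sub>v v) $ i = (\<Sum>j = 0..<n. of_int (c (e i) (e j)) * e j)"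
      using i by (simp add: Ac_def A_def v_def scalar_prod_def)
    also have "\<dots> = (\<Sum>b'\<in>B. of_int (c (e i) b') * b')"
      by (rule sum.reindex_bij_betw[OF e])
    also have "\<dots> = x * e i" using c[OF ei] by simp
    finally show "(Ac *\<^sub>v v) $ i = (x \<cdot>\<^sub>v v) $ i" using i by (simp add: v_def)
  qed (simp add: Ac_def A_def v_def)
  moreover have "v \<noteq> 0\<^sub>v n"
  proof
    assume v0: "v = 0\<^sub>v n"
    obtain i where "i < n" "e i = b0" using e b0(1) by (auto simp: bij_betw_def)
    then have "v $ i = b0" by (simp add: v_def)
    then show False using v0 b0(2) \<open>i < n\<close> by simp
  qed
  ultimately have "eigenvector Ac v x" using Ac by (auto simp: eigenvector_def v_def)
  then have "poly (char_poly Ac) x = 0"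
    using eigenvalue_root_char_poly[OF Ac] by (auto simp: eigenvalue_def)
  then have "poly (ic (char_poly A)) x = 0"
    unfolding Ac_def of_int_hom.char_poly_hom[OF A] .
  moreover have "lead_coeff (char_poly A) = 1" using degree_monic_char_poly[OF A] by metis
  ultimately show ?thesis unfolding algebraic_int_altdef_ipoly by blast
qed

lemma power_reduction:
  assumes "algebraic_int (a :: complex)"
  obtains m c where "m > 0" "a ^ m = (\<Sum>l<m. of_int (c l) * a ^ l)"
proof -
  obtain p where p: "poly (ic p) a = 0" "lead_coeff p = 1"
    using assms by (auto simp: algebraic_int_altdef_ipoly)
  have "degree p > 0" using p by (intro gr0I) (auto elim!: degree_eq_zeroE)
  moreover have "0 = (\<Sum>l\<le>degree p. of_int (poly.coeff p l) * a ^ l)"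
    using p(1) by (simp add: poly_altdef)
  then have "a ^ degree p = (\<Sum>l<degree p. of_int (- poly.coeff p l) * a ^ l)"
    using p(2) by (simp add: lessThan_Suc_atMost[symmetric] sum_negf add_eq_0_iff)
  ultimately show ?thesis by (rule that)
qed

text \<open>The products \<open>a ^ i * b ^ j\<close>, with exponents below the degrees of monic
  equations for \<open>a\<close> and \<open>b\<close>, span a lattice stable under both numbers,
  hence under their sum and product.\<close>

lemma algebraic_int_add_mult:
  assumes "algebraic_int (a :: complex)" "algebraic_int b"
  shows "algebraic_int (a + b) \<and> algebraic_int (a * b)"
proof -
  obtain m c where m: "m > 0" "a ^ m = (\<Sum>l<m. of_int (c l) * a ^ l)"
    using power_reduction[OF assms(1)] .
  obtain n d where n: "n > 0" "b ^ n = (\<Sum>l<n. of_int (d l) * b ^ l)"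
    using power_reduction[OF assms(2)] .
  define B where "B = (\<lambda>(i, j). a ^ i * b ^ j) ` ({..<m} \<times> {..<n})"
  have fin: "finite B" by (simp add: B_def)
  have mem: "a ^ i * b ^ j \<in> zspan B" if "i < m" "j < n" for i j
    using that by (intro zspan_base fin) (auto simp: B_def)
  have one: "1 \<in> B" using m(1) n(1) by (auto simp: B_def intro!: image_eqI[where x = "(0,0)"])
  have aB: "a * y \<in> zspan B" if "y \<in> B" for y
  proof -
    obtain i j where ij: "i < m" "j < n" "y = a ^ i * b ^ j" using \<open>y \<in> B\<close> by (auto simp: B_def)
    show ?thesis
    proof (cases "Suc i < m")
      case True
      then show ?thesis using mem[of "Suc i" j] ij by (simp add: mult.assoc)
    next
      case False
      then have "m = Suc i" using ij by simp
      then have "a * y = a ^ m * b ^ j" using ij by simp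
      also have "\<dots> = (\<Sum>l<m. of_int (c l) * (a ^ l * b ^ j))"
        by (simp add: m(2) sum_distrib_right mult.assoc)
      also have "\<dots> \<in> zspan B" using mem ij by (intro zspan_sum zspan_int_mult) auto
      finally show ?thesis .
    qed
  qed
  have bB: "b * y \<in> zspan B" if "y \<in> B" for y
  proof -
    obtain i j where ij: "i < m" "j < n" "y = a ^ i * b ^ j" using \<open>y \<in> B\<close> by (auto simp: B_def)
    show ?thesis
    proof (cases "Suc j < n")
      case True
      then show ?thesis using mem[of i "Suc j"] ij by (simp add: algebra_simps)
    next
      case False
      then have "n = Suc j" using ij by simp
      then have "b * y = b ^ n * a ^ i" using ij by simp
      also have "\<dots> = (\<Sum>l<n. of_int (d l) * (a ^ i * b ^ l))"
        by (simp add: n(2) sum_distrib_right mult.assoc mult.commute[of "a ^ i"])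
      also have "\<dots> \<in> zspan B" using mem ij by (intro zspan_sum zspan_int_mult) auto
      finally show ?thesis .
    qed
  qed
  have "algebraic_int (a + b)"
    using aB bB by (intro algebraic_int_if_stable_span[OF fin one]) (auto simp: distrib_right zspan_add)
  moreover have "algebraic_int (a * b)"
    using zspan_mult_closed[OF aB bB]
    by (intro algebraic_int_if_stable_span[OF fin one]) (auto simp: mult.assoc)
  ultimately show ?thesis ..
qed

lemma algebraic_int_add: "algebraic_int a \<Longrightarrow> algebraic_int b \<Longrightarrow> algebraic_int (a + b :: complex)"
  and algebraic_int_mult: "algebraic_int a \<Longrightarrow> algebraic_int b \<Longrightarrow> algebraic_int (a * b :: complex)"
  using algebraic_int_add_mult by blast+

lemma algebraic_int_power: "algebraic_int a \<Longrightarrow> algebraic_int (a ^ k :: complex)"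
  by (induction k) (auto intro: algebraic_int_mult)

lemma algebraic_int_sum: "(\<And>i. i \<in> I \<Longrightarrow> algebraic_int (f i)) \<Longrightarrow> algebraic_int (sum f I :: complex)"
  by (induction I rule: infinite_finite_induct) (auto intro: algebraic_int_add)

section \<open>Mahler measure and counting\<close>

lemma mahler_prod_linear:
  "finite A \<Longrightarrow> mahler_measure_poly (\<Prod>z\<in>A. [:- f z, 1:]) = (\<Prod>z\<in>A. max 1 (cmod (f z)))"
proof (induction A rule: finite_induct)
  case empty
  show ?case using mahler_measure_constant[of 1] by (simp only: prod.empty pCons_one norm_one)
next
  case (insert a A)
  have lin: "mahler_measure_poly [:- f a, 1:] = max 1 (cmod (f a))"
    by simp
  show ?case unfolding prod.insert[OF insert.hyps] measure_eq_prod lin insert.IH ..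
qed

lemma mahler_minpoly:
  assumes "minpoly_of x g"
  shows "mahler_measure g = (\<Prod>z | poly (ic g) z = 0. max 1 (cmod z))"
proof -
  have "mahler_measure g = mahler_measure_poly (\<Prod>z\<in>{z. poly (ic g) z = 0}. [:- z, 1:])"
    unfolding mahler_measure_def using arg_cong[OF minpoly_eq_prod_roots[OF assms], of mahler_measure_poly] .
  also have "\<dots> = (\<Prod>z | poly (ic g) z = 0. max 1 (cmod z))"
    by (rule mahler_prod_linear[OF minpoly_roots_finite[OF assms]])
  finally show ?thesis .
qed

lemma mahler_measure_mult: "mahler_measure (f * g) = mahler_measure f * mahler_measure g"
  by (simp add: mahler_measure_def of_int_poly_hom.hom_mult measure_eq_prod)

text \<open>Landau's inequality compares with the Euclidean norm of the coefficients; the factor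
  \<open>degree f + 1\<close> is a crude replacement for its square root.\<close>

lemma mahler_measure_le_height:
  assumes "\<And>k. \<bar>poly.coeff f k\<bar> \<le> int H"
  shows "mahler_measure f \<le> real (degree f + 1) * real H"
proof -
  have "mahler_measure f \<le> l2norm_complex (ic f)"
    unfolding mahler_measure_def by (rule Landau_inequality)
  also have "\<dots> \<le> sqrt (\<Sum>a\<leftarrow>coeffs (ic f). (real H)\<^sup>2)"
  proof (intro real_sqrt_le_mono sum_list_mono power_mono norm_ge_zero)
    fix a assume "a \<in> set (coeffs (ic f))"
    then have "a \<in> range (poly.coeff (ic f))" unfolding range_coeff by blast
    then obtain k where "a = of_int (poly.coeff f k)" by auto
    then have "cmod a = of_int \<bar>poly.coeff f k\<bar>" by simp
    also have "\<dots> \<le> of_int (int H)" using assms[of k] by (simp only: of_int_le_iff)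
    finally show "cmod a \<le> real H" by simp
  qed
  also have "\<dots> = sqrt (real (length (coeffs (ic f)))) * real H"
    unfolding sum_list_triv by (simp add: real_sqrt_mult)
  also have "\<dots> \<le> real (degree f + 1) * real H"
  proof (rule mult_right_mono)
    have "length (coeffs (ic f)) \<le> degree f + 1" by (cases "f = 0") (simp_all add: length_coeffs_degree)
    then have "sqrt (real (length (coeffs (ic f)))) \<le> sqrt (real (degree f + 1))" by simp
    also have "\<dots> \<le> real (degree f + 1)" by (intro real_le_lsqrt) (auto simp: power2_eq_square)
    finally show "sqrt (real (length (coeffs (ic f)))) \<le> real (degree f + 1)" .
  qed simp
  finally show ?thesis .
qed

section \<open>Monic integer polynomials of bounded Mahler measure\<close>

definition monic_mahler :: "nat \<Rightarrow> real \<Rightarrow> int poly set" where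
  "monic_mahler m B = {g. lead_coeff g = 1 \<and> degree g = m \<and> mahler_measure g \<le> B}"

lemma monic_mahler_coeff_bound:
  assumes "g \<in> monic_mahler m B"
  shows "\<bar>poly.coeff g k\<bar> \<le> \<lfloor>2 ^ m * B\<rfloor>"
proof -
  have g: "degree g = m" "mahler_measure g \<le> B" using assms by (auto simp: monic_mahler_def)
  have "of_int \<bar>poly.coeff g k\<bar> \<le> real (degree g choose k) * mahler_measure g" by (rule Mignotte_bound)
  have le: "real (m choose k) \<le> 2 ^ m"
  proof -
    have "real (m choose k) \<le> real (2 ^ m)" using binomial_le_pow2[of m k] by (simp only: of_nat_le_iff)
    then show ?thesis by simp
  qed
  note \<open>of_int \<bar>poly.coeff g k\<bar> \<le> real (degree g choose k) * mahler_measure g\<close>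
  also have "real (degree g choose k) * mahler_measure g \<le> 2 ^ m * B"
    unfolding g(1) using g(2) mahler_measure_ge_0[of g]
    by (intro mult_mono le) simp_all
  finally show ?thesis by (simp add: le_floor_iff)
qed

lemma monic_bounded_polys:
  fixes b :: int and m :: nat
  assumes "b \<ge> 0"
  defines "P \<equiv> {g :: int poly. lead_coeff g = 1 \<and> degree g = m \<and> (\<forall>k<m. \<bar>poly.coeff g k\<bar> \<le> b)}"
  shows "finite P" "card P \<le> nat (2 * b + 1) ^ m"
proof -
  define F where "F = (\<lambda>g :: int poly. map (poly.coeff g) [0..<m])"
  have inj: "inj_on F P"
  proof (rule inj_onI)
    fix g h assume gh: "g \<in> P" "h \<in> P" "F g = F h"
    show "g = h"
    proof (rule poly_eqI)
      fix k
      consider "k < m" | "k = m" | "k > m" by linarith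
      then show "poly.coeff g k = poly.coeff h k"
      proof cases
        case 1 then show ?thesis using gh(3) by (simp add: F_def)
      next
        case 2 then show ?thesis using gh(1,2) by (auto simp: P_def)
      next
        case 3 then show ?thesis using gh(1,2) by (auto simp: P_def coeff_eq_0)
      qed
    qed
  qed
  have sub: "F ` P \<subseteq> {xs. set xs \<subseteq> {-b..b} \<and> length xs = m}"
  proof
    fix xs assume "xs \<in> F ` P"
    then obtain g where g: "g \<in> P" "xs = F g" by blast
    have "poly.coeff g k \<in> {-b..b}" if "k < m" for k
      using g(1) that by (force simp: P_def abs_le_iff)
    then show "xs \<in> {xs. set xs \<subseteq> {-b..b} \<and> length xs = m}" by (auto simp: g(2) F_def)
  qed
  have fin: "finite {xs. set xs \<subseteq> {-b..b} \<and> length xs = m}" by (rule finite_lists_length_eq) simp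
  show "finite P" using inj sub fin by (rule inj_on_finite)
  have "card P \<le> card {xs. set xs \<subseteq> {-b..b} \<and> length xs = m}"
    using card_inj_on_le[OF inj sub fin] .
  also have "\<dots> = nat (2 * b + 1) ^ m" by (subst card_lists_length_eq) (auto simp: algebra_simps)
  finally show "card P \<le> nat (2 * b + 1) ^ m" .
qed

lemma finite_monic_mahler: "finite (monic_mahler m B)"
proof (cases "B \<ge> 0")
  case True
  have "monic_mahler m B \<subseteq> {g :: int poly. lead_coeff g = 1 \<and> degree g = m \<and> (\<forall>k<m. \<bar>poly.coeff g k\<bar> \<le> \<lfloor>2 ^ m * B\<rfloor>)}"
    using monic_mahler_coeff_bound by (auto simp: monic_mahler_def)
  then show ?thesis by (rule finite_subset) (rule monic_bounded_polys(1), use True in simp)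
next
  case False
  have "g \<notin> monic_mahler m B" for g
    using False mahler_measure_ge_0[of g] unfolding monic_mahler_def by simp
  then have "monic_mahler m B = {}" by blast
  then show ?thesis by simp
qed

text \<open>There are \<open>m\<close> coefficients below the leading one, and Mignotte's bound
  confines each to an interval of length O(B).\<close>

lemma card_monic_mahler:
  assumes "B \<ge> 1"
  shows "real (card (monic_mahler m B)) \<le> (2 ^ (m + 2) * B) ^ m"
proof -
  define b where "b = \<lfloor>2 ^ m * B\<rfloor>"
  have b0: "b \<ge> 0" using assms by (simp add: b_def)
  have "monic_mahler m B \<subseteq> {g :: int poly. lead_coeff g = 1 \<and> degree g = m \<and> (\<forall>k<m. \<bar>poly.coeff g k\<bar> \<le> b)}"
    using monic_mahler_coeff_bound by (auto simp: monic_mahler_def b_def)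
  then have "card (monic_mahler m B) \<le> nat (2 * b + 1) ^ m"
    using card_mono[OF monic_bounded_polys(1)[OF b0]] monic_bounded_polys(2)[OF b0, of m] by (meson order_trans)
  then have "real (card (monic_mahler m B)) \<le> real (nat (2 * b + 1) ^ m)" by (simp only: of_nat_le_iff)
  also have "\<dots> = real (nat (2 * b + 1)) ^ m" by simp
  also have "\<dots> \<le> (2 ^ (m + 2) * B) ^ m"
  proof (rule power_mono)
    \<comment> \<open>Since X \<ge> 1, one has 2 b + 1 \<le> 3 X \<le> 4 X; the factor 4 accounts
      for the exponent \<open>m + 2\<close>.\<close>
    define X where "X = 2 ^ m * B"
    have "1 * 1 \<le> X" unfolding X_def using assms by (intro mult_mono) auto
    moreover have "2 ^ (m + 2) * B = 4 * X" by (simp add: X_def)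
    moreover have "of_int b \<le> X" by (simp add: b_def X_def)
    ultimately show "real (nat (2 * b + 1)) \<le> 2 ^ (m + 2) * B" using b0 by simp
  qed simp
  finally show ?thesis .
qed

section \<open>Orders of quotients of roots\<close>

definition unity_bounded :: "nat \<Rightarrow> complex set" where
  "unity_bounded D = {\<zeta>. (\<exists>k>0. \<zeta> ^ k = 1) \<and> (\<exists>g. minpoly_of \<zeta> g \<and> degree g \<le> D)}"

text \<open>All conjugates of a root of unity lie on the unit circle, so its minimal polynomial has
  Mahler measure 1; in bounded degree there are finitely many such polynomials.\<close>

lemma finite_unity_bounded: "finite (unity_bounded D)"
proof -
  have sub: "unity_bounded D \<subseteq> (\<Union>m\<in>{..D}. \<Union>g\<in>monic_mahler m 1. {z. poly (ic g) z = 0})"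
  proof
    fix \<zeta> assume "\<zeta> \<in> unity_bounded D"
    then obtain k g where k: "k > 0" "\<zeta> ^ k = 1" and g: "minpoly_of \<zeta> g" "degree g \<le> D"
      by (auto simp: unity_bounded_def)
    have "cmod z = 1" if z: "poly (ic g) z = 0" for z
    proof -
      have "poly (rp (Polynomial.monom 1 k - 1)) \<zeta> = 0" using k by (simp add: of_rat_poly_hom.hom_minus poly_monom)
      from minpoly_root_transfer[OF g(1) this z] have "z ^ k = 1"
        by (simp add: of_rat_poly_hom.hom_minus poly_monom)
      then have "cmod z ^ k = 1" by (metis norm_one norm_power)
      then show ?thesis using k(1) using power_eq_iff_eq_base[of k "cmod z" 1] k(1) by simp
    qed
    then have "mahler_measure g = 1" unfolding mahler_minpoly[OF g(1)] by simp
    then have "g \<in> monic_mahler (degree g) 1" using g(1) by (auto simp: monic_mahler_def minpoly_of_def)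
    moreover have "poly (ic g) \<zeta> = 0" using g(1) by (simp add: minpoly_of_def)
    ultimately show "\<zeta> \<in> (\<Union>m\<in>{..D}. \<Union>g\<in>monic_mahler m 1. {z. poly (ic g) z = 0})" using g(2) by auto
  qed
  have roots: "finite {z. poly (ic g) z = 0}" if "g \<in> monic_mahler m 1" for m g
    using that by (intro poly_roots_finite) (auto simp: monic_mahler_def)
  show ?thesis by (rule finite_subset[OF sub]) (use roots finite_monic_mahler in blast)
qed

text \<open>The quotient is a root of a rational polynomial of degree n^2, the product of linear
  factors over all pairs of roots. Its rationality follows because the power sums over pairs factor
  into sums over each coordinate.\<close>

lemma ratio_in_unity_bounded:
  assumes f: "lead_coeff f = 1" and a: "poly (ic f) \<alpha> = 0" and b: "poly (ic f) \<beta> = 0" "\<beta> \<noteq> 0"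
    and k: "k > 0" "(\<alpha> / \<beta>) ^ k = 1"
  shows "\<alpha> / \<beta> \<in> unity_bounded (degree f ^ 2)"
proof -
  define n where "n = degree f"
  \<comment> \<open>The polynomial may have multiple roots, so its roots are indexed with
    multiplicity instead of being collected in a set.\<close>
  define as where "as = complex_roots_int f"
  have len: "length as = n" by (simp add: as_def n_def complex_roots_int)
  define z where "z = (\<lambda>i. as ! i)"
  have "ic f = (\<Prod>a\<leftarrow>as. [:- a, 1:])" using complex_roots_int(1)[of f] f by (simp add: as_def)
  also have "\<dots> = (\<Prod>i\<in>{..<n}. [:- z i, 1:])"
    unfolding prod.list_conv_set_nth by (simp add: len z_def atLeast0LessThan)
  finally have fz: "ic f = (\<Prod>i\<in>{..<n}. [:- z i, 1:])" .
  have rat: "rational_coeffs (\<Prod>i\<in>{..<n}. [:- z i, 1:])" unfolding fz[symmetric] by simp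
  have "algebraic_int \<beta>" using b f by (auto simp: algebraic_int_altdef_ipoly)
  then obtain g\<beta> where g\<beta>: "minpoly_of \<beta> g\<beta>" by (rule minpoly_exists)
  have nz: "poly (rp (Polynomial.monom 1 1)) \<beta> \<noteq> 0" using b(2) by (simp add: poly_monom)
  obtain v where "\<And>y. poly (ic g\<beta>) y = 0 \<Longrightarrow> poly (rp v) y * poly (rp (Polynomial.monom 1 1)) y = 1"
    using minpoly_inverse[OF g\<beta> nz] by blast
  from this[of \<beta>] have v: "poly (rp v) \<beta> * \<beta> = 1" using g\<beta> by (simp add: minpoly_of_def poly_monom)
  define I where "I = {..<n} \<times> {..<n}"
  \<comment> \<open>Inverting every root is impossible, as 0 may be one. The polynomial
    \<open>v\<close> inverts \<beta>; whatever values it takes at the other roots, the product over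
    all pairs stays rational.\<close>
  define w where "w = (\<lambda>(i, j). z i * poly (rp v) (z j))"
  have "rational_coeffs (\<Prod>p\<in>I. [:- w p, 1:])"
  proof (rule rational_coeffs_of_power_sums)
    fix k :: nat
    have "(\<Sum>p\<in>I. w p ^ k) = (\<Sum>i<n. z i ^ k) * (\<Sum>j<n. poly (rp (v ^ k)) (z j))"
      unfolding I_def w_def sum_product sum.cartesian_product
      by (intro sum.cong) (auto simp: power_mult_distrib of_rat_poly_hom.hom_power)
    also have "\<dots> \<in> \<rat>"
      by (intro Rats_mult poly_rp_sum_rational power_sums_rational rat) auto
    finally show "(\<Sum>p\<in>I. w p ^ k) \<in> \<rat>" .
  qed (simp add: I_def)
  then obtain t where t: "(\<Prod>p\<in>I. [:- w p, 1:]) = rp t" by (rule rational_coeffsE)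
  obtain i where i: "i < n" "z i = \<alpha>" using a unfolding fz poly_prod by (auto simp: prod_zero_iff)
  obtain j where j: "j < n" "z j = \<beta>" using b unfolding fz poly_prod by (auto simp: prod_zero_iff)
  have wij: "w (i, j) = \<alpha> / \<beta>" using i j v b(2) by (simp add: w_def field_simps)
  have root: "poly (rp t) (\<alpha> / \<beta>) = 0"
    unfolding t[symmetric] poly_prod
  proof (rule prod_zero)
    show "\<exists>p\<in>I. poly [:- w p, 1:] (\<alpha> / \<beta>) = 0"
      using i j wij by (intro bexI[of _ "(i, j)"]) (simp_all add: I_def)
  qed (simp add: I_def)
  have "algebraic_int (\<alpha> / \<beta>)"
    unfolding algebraic_int_altdef_ipoly
  proof (intro exI[of _ "Polynomial.monom 1 k - 1"] conjI)
    show "poly (ic (Polynomial.monom 1 k - 1)) (\<alpha> / \<beta>) = 0" using k by (simp add: of_int_poly_hom.hom_minus poly_monom)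
    have "degree (Polynomial.monom 1 k - 1 :: int poly) = k"
      using k(1) by (subst diff_conv_add_uminus, subst degree_add_eq_left) (auto simp: degree_monom_eq)
    then show "lead_coeff (Polynomial.monom 1 k - 1 :: int poly) = 1" using k(1) by simp
  qed
  then obtain g where g: "minpoly_of (\<alpha> / \<beta>) g" by (rule minpoly_exists)
  have "ir g dvd t" by (rule minpoly_dvd[OF g root])
  moreover have "t \<noteq> 0"
  proof
    assume "t = 0"
    then have "lead_coeff (\<Prod>p\<in>I. [:- w p, 1:]) = 0" unfolding t by simp
    then show False using lead_coeff_prod_linear[of w I] by simp
  qed
  ultimately have "degree g \<le> degree t" using dvd_imp_degree_le[of "ir g" t] by simp
  also have "degree t = degree (rp t)" by simp
  also have "\<dots> = n ^ 2" unfolding t[symmetric] degree_prod_linear by (simp add: I_def power2_eq_square)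
  finally show ?thesis using k g by (auto simp: unity_bounded_def n_def)
qed

text \<open>\<open>N\<close> is the product of orders of the finitely many possible quotients, so it
  is a common exponent that depends on \<open>n\<close> only.\<close>

lemma bounded_ratio_order:
  obtains N where "N > 0"
    "\<And>f \<alpha> \<beta> k. lead_coeff f = 1 \<Longrightarrow> degree f = n \<Longrightarrow> poly (ic f) \<alpha> = 0 \<Longrightarrow> poly (ic f) \<beta> = 0 \<Longrightarrow>
       \<beta> \<noteq> 0 \<Longrightarrow> k > 0 \<Longrightarrow> (\<alpha> / \<beta>) ^ k = 1 \<Longrightarrow> \<alpha> ^ N = \<beta> ^ N"
proof -
  define U where "U = unity_bounded (n ^ 2)"
  have "\<forall>\<zeta>\<in>U. \<exists>k>0. \<zeta> ^ k = 1" by (auto simp: U_def unity_bounded_def)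
  then obtain ord where ord: "\<And>\<zeta>. \<zeta> \<in> U \<Longrightarrow> ord \<zeta> > 0 \<and> \<zeta> ^ ord \<zeta> = 1" by metis
  define N where "N = (\<Prod>\<zeta>\<in>U. ord \<zeta>)"
  have fin: "finite U" unfolding U_def by (rule finite_unity_bounded)
  show ?thesis
  proof (rule that[of N])
    show "N > 0" unfolding N_def using ord by (intro prod_pos) auto
    fix f \<alpha> \<beta> k
    assume *: "lead_coeff f = 1" "degree f = n" "poly (ic f) \<alpha> = 0" "poly (ic f) \<beta> = 0"
      "\<beta> \<noteq> 0" "k > (0::nat)" "(\<alpha> / \<beta>) ^ k = 1"
    then have mem: "\<alpha> / \<beta> \<in> U" using ratio_in_unity_bounded[of f \<alpha> \<beta> k] by (simp add: U_def)
    then have "ord (\<alpha> / \<beta>) dvd N" unfolding N_def using fin by (intro dvd_prodI)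
    then obtain m where "N = ord (\<alpha> / \<beta>) * m" by (auto simp: dvd_def)
    then have "(\<alpha> / \<beta>) ^ N = 1" using ord[OF mem] by (simp add: power_mult)
    then show "\<alpha> ^ N = \<beta> ^ N" using \<open>\<beta> \<noteq> 0\<close> by (simp add: power_divide)
  qed
qed

section \<open>Conjugates whose quotients are roots of unity\<close>

abbreviation roots :: "int poly \<Rightarrow> complex set" where "roots g \<equiv> {z. poly (ic g) z = 0}"

definition power_class :: "int poly \<Rightarrow> nat \<Rightarrow> complex \<Rightarrow> complex set" where
  "power_class g N w = {y \<in> roots g. y ^ N = w}"

lemma poly_pderiv_sum:
  fixes p :: "complex poly"
  shows "poly (pderiv p) x = (\<Sum>j\<le>degree p. poly.coeff p j * (of_nat j * x ^ (j - 1)))"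
proof -
  have "poly (pderiv p) x = poly (pderiv (\<Sum>j\<le>degree p. Polynomial.monom (poly.coeff p j) j)) x"
    by (simp add: poly_as_sum_of_monoms)
  also have "\<dots> = (\<Sum>j\<le>degree p. poly.coeff p j * (of_nat j * x ^ (j - 1)))"
    by (simp add: higher_pderiv_sum pderiv_sum pderiv_monom poly_sum poly_monom algebra_simps)
  finally show ?thesis .
qed

text \<open>The divided difference \<open>(p(t) - p(w)) / (t - w)\<close> as a polynomial in both arguments.\<close>

definition divided_diff :: "complex poly \<Rightarrow> complex \<Rightarrow> complex \<Rightarrow> complex" where
  "divided_diff p t w = (\<Sum>j\<le>degree p. poly.coeff p j * (\<Sum>i<j. w ^ (j - Suc i) * t ^ i))"

lemma divided_diff_mult: "(t - w) * divided_diff p t w = poly p t - poly p w"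
proof -
  have "poly p t - poly p w = (\<Sum>j\<le>degree p. poly.coeff p j * (t ^ j - w ^ j))"
    by (simp add: poly_altdef sum_subtractf[symmetric] algebra_simps)
  also have "\<dots> = (\<Sum>j\<le>degree p. poly.coeff p j * ((t - w) * (\<Sum>i<j. w ^ (j - Suc i) * t ^ i)))"
    by (simp only: power_diff_sumr2)
  also have "\<dots> = (t - w) * divided_diff p t w"
    unfolding divided_diff_def by (simp add: sum_distrib_left mult.left_commute)
  finally show ?thesis ..
qed

lemma divided_diff_same: "divided_diff p w w = poly (pderiv p) w"
  unfolding divided_diff_def poly_pderiv_sum
proof (intro sum.cong refl arg_cong2[where f = "(*)"])
  fix j
  have "(\<Sum>i<j. w ^ (j - Suc i) * w ^ i) = (\<Sum>i<j. w ^ (j - 1))"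
    by (intro sum.cong refl) (simp flip: power_add)
  then show "(\<Sum>i<j. w ^ (j - Suc i) * w ^ i) = of_nat j * w ^ (j - 1)" by simp
qed

text \<open>One inclusion transfers the vanishing of \<open>W\<close> composed with X^N from
  \<alpha> to its conjugates; the other holds since the product of X - z^N over the conjugates z is
  rational and vanishes at \<open>\<alpha> ^ N\<close>.\<close>

lemma power_roots_minpoly:
  assumes g: "minpoly_of \<alpha> g"
  obtains W where "minpoly_of (\<alpha> ^ N) W" "roots W = (\<lambda>z. z ^ N) ` roots g"
proof -
  have "algebraic_int \<alpha>" using g by (auto simp: minpoly_of_def algebraic_int_altdef_ipoly)
  then have "algebraic_int (\<alpha> ^ N)" by (rule algebraic_int_power)
  then obtain W where W: "minpoly_of (\<alpha> ^ N) W" by (rule minpoly_exists)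
  define X where "X = (Polynomial.monom 1 N :: rat poly)"
  have X: "poly (rp X) z = z ^ N" for z by (simp add: X_def poly_monom)
  have comp: "poly (rp (pcompose (ir W) X)) z = poly (ic W) (z ^ N)" for z
    by (simp add: of_rat_hom.map_poly_pcompose poly_pcompose X)
  have "z ^ N \<in> roots W" if "z \<in> roots g" for z
    using minpoly_root_transfer[OF g, of "pcompose (ir W) X" z] W that by (simp add: comp minpoly_of_def)
  moreover have "y \<in> (\<lambda>z. z ^ N) ` roots g" if "y \<in> roots W" for y
  proof -
    have "rational_coeffs (\<Prod>z\<in>roots g. [:- poly (rp X) z, 1:])"
      using rational_coeffs_prod_image[OF minpoly_roots_finite[OF g], of "\<lambda>z. z" X]
      unfolding minpoly_eq_prod_roots[OF g, symmetric] by simp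
    then obtain t where t: "(\<Prod>z\<in>roots g. [:- poly (rp X) z, 1:]) = rp t" by (rule rational_coeffsE)
    have root: "poly (rp t) x = 0 \<longleftrightarrow> (\<exists>z\<in>roots g. x = z ^ N)" for x
      unfolding t[symmetric] poly_prod using minpoly_roots_finite[OF g]
      by (subst prod_zero_iff) (auto simp: X)
    have "poly (rp t) (\<alpha> ^ N) = 0" unfolding root using g by (auto simp: minpoly_of_def)
    then have "poly (rp t) y = 0" using minpoly_root_transfer[OF W] that by blast
    then show ?thesis unfolding root by blast
  qed
  ultimately have "roots W = (\<lambda>z. z ^ N) ` roots g" by blast
  with W show ?thesis by (rule that)
qed

text \<open>Lagrange interpolation at the conjugates of \<open>\<alpha> ^ N\<close> expresses the power sum over one class
  through power sums over all conjugates of \<open>\<alpha>\<close>, by a formula that is the same for every class.\<close>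

lemma class_power_sum_poly:
  assumes g: "minpoly_of \<alpha> g"
  shows "\<exists>P. \<forall>z\<in>roots g. (\<Sum>y\<in>power_class g N (z ^ N). y ^ k) = poly (rp P) z"
proof -
  obtain W where W: "minpoly_of (\<alpha> ^ N) W" "roots W = (\<lambda>z. z ^ N) ` roots g"
    by (rule power_roots_minpoly[OF g])
  have fin: "finite (roots g)" using g by (rule minpoly_roots_finite)
  have "(\<Sum>z\<in>roots g. z ^ m) \<in> \<rat>" for m
    using power_sums_rational[OF fin, of "\<lambda>z. z" m]
    unfolding minpoly_eq_prod_roots[OF g, symmetric] by simp
  then have "\<forall>m. \<exists>s. (\<Sum>z\<in>roots g. z ^ m) = of_rat s" by (simp add: Rats_def image_def)
  then obtain s where s: "\<And>m. (\<Sum>z\<in>roots g. z ^ m) = of_rat (s m)" by metis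
  \<comment> \<open>Interpolation divides by the derivative of \<open>W\<close> at \<open>w\<close>;
    \<open>V\<close> turns this division into evaluation of a rational polynomial.\<close>
  obtain V where V: "\<forall>w. poly (ic W) w = 0 \<longrightarrow> poly (rp V) w * poly (rp (pderiv (ir W))) w = 1"
    using minpoly_inverse[OF W(1) minpoly_pderiv_nonzero[OF W(1)]] by blast
  have dW: "rp (pderiv (ir W)) = pderiv (ic W)" by (metis of_rat_hom.map_poly_pderiv rp_ir)
  \<comment> \<open>At \<open>w\<close> this is the sum over all conjugates y of y^k times the
    divided difference at (y^N, w), expanded in powers of \<open>w\<close>, with the power sums over
    the conjugates entered as the rational numbers \<open>s\<close>.\<close>
  define Q where "Q = (\<Sum>j\<le>degree W. \<Sum>i<j.
     Polynomial.monom (of_int (poly.coeff W j) * s (k + N * i)) (j - Suc i))"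
  define P where "P = pcompose (V * Q) (Polynomial.monom 1 N)"
  show ?thesis
  proof (rule exI[of _ P], rule ballI)
    fix z assume z: "z \<in> roots g"
    define w where "w = z ^ N"
    have w: "poly (ic W) w = 0" using W(2) z unfolding w_def by blast
    \<comment> \<open>The divided difference of \<open>ic W\<close> vanishes at two distinct roots
      of \<open>W\<close>, so only the class of \<open>w\<close> survives.\<close>
    have "(\<Sum>y\<in>roots g. y ^ k * divided_diff (ic W) (y ^ N) w)
        = (\<Sum>y\<in>power_class g N w. y ^ k * divided_diff (ic W) (y ^ N) w)"
    proof (rule sum.mono_neutral_right[OF fin])
      show "\<forall>y\<in>roots g - power_class g N w. y ^ k * divided_diff (ic W) (y ^ N) w = 0"
      proof
        fix y assume y: "y \<in> roots g - power_class g N w"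
        then have "poly (ic W) (y ^ N) = 0" "y ^ N - w \<noteq> 0" using W(2) by (auto simp: power_class_def)
        then show "y ^ k * divided_diff (ic W) (y ^ N) w = 0"
          using divided_diff_mult[of "y ^ N" w "ic W"] w by simp
      qed
    qed (auto simp: power_class_def)
    also have "\<dots> = (\<Sum>y\<in>power_class g N w. y ^ k * poly (pderiv (ic W)) w)"
      by (intro sum.cong refl) (simp add: power_class_def divided_diff_same)
    also have "\<dots> = poly (pderiv (ic W)) w * (\<Sum>y\<in>power_class g N w. y ^ k)"
      by (simp add: sum_distrib_left mult.commute)
    finally have 1: "(\<Sum>y\<in>roots g. y ^ k * divided_diff (ic W) (y ^ N) w)
      = poly (pderiv (ic W)) w * (\<Sum>y\<in>power_class g N w. y ^ k)" .
    have "poly (rp Q) w = (\<Sum>j\<le>degree W. \<Sum>i<j. of_int (poly.coeff W j) * (\<Sum>y\<in>roots g. y ^ (k + N * i)) * w ^ (j - Suc i))"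
      unfolding Q_def of_rat_poly_hom.hom_sum poly_sum s
      by (simp add: poly_monom of_rat_mult)
    also have "\<dots> = (\<Sum>j\<le>degree W. \<Sum>i<j. \<Sum>y\<in>roots g. of_int (poly.coeff W j) * y ^ (k + N * i) * w ^ (j - Suc i))"
      by (simp only: sum_distrib_left sum_distrib_right)
    also have "\<dots> = (\<Sum>j\<le>degree W. \<Sum>y\<in>roots g. \<Sum>i<j. of_int (poly.coeff W j) * y ^ (k + N * i) * w ^ (j - Suc i))"
      by (intro sum.cong refl sum.swap)
    also have "\<dots> = (\<Sum>y\<in>roots g. \<Sum>j\<le>degree W. \<Sum>i<j. of_int (poly.coeff W j) * y ^ (k + N * i) * w ^ (j - Suc i))"
      by (rule sum.swap)
    also have "\<dots> = (\<Sum>y\<in>roots g. y ^ k * divided_diff (ic W) (y ^ N) w)"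
      unfolding divided_diff_def
      by (simp only: sum_distrib_left power_add power_mult) (simp add: mult_ac)
    finally have 2: "poly (rp Q) w = poly (pderiv (ic W)) w * (\<Sum>y\<in>power_class g N w. y ^ k)" using 1 by simp
    have "poly (rp P) z = poly (rp V) w * poly (rp Q) w"
      by (simp add: P_def of_rat_hom.map_poly_pcompose poly_pcompose of_rat_poly_hom.hom_mult poly_monom w_def)
    also have "\<dots> = (poly (rp V) w * poly (pderiv (ic W)) w) * (\<Sum>y\<in>power_class g N w. y ^ k)"
      unfolding 2 by (rule mult.assoc[symmetric])
    also have "poly (rp V) w * poly (pderiv (ic W)) w = 1" using V w unfolding dW by blast
    finally show "(\<Sum>y\<in>power_class g N (z ^ N). y ^ k) = poly (rp P) z" by (simp add: w_def)
  qed
qed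

lemma rp_const [simp]: "rp [:c:] = [:of_rat c:]"
  by (rule poly_eqI) (simp add: coeff_map_poly coeff_pCons split: nat.splits)

text \<open>The case \<open>k = 0\<close> of the class power sums: the class size is the value of a
  rational polynomial at \<open>z\<close>, and this polynomial minus the constant \<open>s\<close>
  vanishes at \<alpha>, hence at \<open>z\<close>.\<close>

lemma card_power_class_constant:
  assumes g: "minpoly_of \<alpha> g" and z: "z \<in> roots g"
  shows "card (power_class g N (z ^ N)) = card (power_class g N (\<alpha> ^ N))"
proof -
  obtain P where P: "\<And>z. z \<in> roots g \<Longrightarrow> (\<Sum>y\<in>power_class g N (z ^ N). y ^ 0) = poly (rp P) z"
    using class_power_sum_poly[OF g, where N = N and k = 0] by blast
  have a: "\<alpha> \<in> roots g" using g by (simp add: minpoly_of_def)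
  define s where "s = card (power_class g N (\<alpha> ^ N))"
  have "poly (rp (P - [:of_nat s:])) \<alpha> = 0"
    using P[OF a] by (simp add: of_rat_poly_hom.hom_minus s_def)
  then have "poly (rp (P - [:of_nat s:])) z = 0" using minpoly_root_transfer[OF g] z by blast
  then have "of_nat (card (power_class g N (z ^ N))) = (of_nat s :: complex)"
    using P[OF z] by (simp add: of_rat_poly_hom.hom_minus)
  then show ?thesis by (simp add: s_def)
qed

text \<open>A superset of the possible ratios between a class power sum and
  \<open>\<alpha> ^ k\<close>; taking all sets of \<open>N\<close>-th roots of unity makes it
  independent of \<alpha>.\<close>

definition unity_sums :: "nat \<Rightarrow> nat \<Rightarrow> complex set" where
  "unity_sums N k = (\<lambda>Y. \<Sum>u\<in>Y. u ^ k) ` Pow {u. u ^ N = 1}"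

lemma finite_unity_sums: "N > 0 \<Longrightarrow> finite (unity_sums N k)"
  unfolding unity_sums_def by (intro finite_imageI) (simp add: finite_roots_unity)

text \<open>Each class of conjugates of \<open>\<alpha>\<close> with the same \<open>N\<close>-th power contributes a single conjugate of the
  power sum \<open>t\<close>, of absolute value bounded by a constant times the contribution of the class to the
  Mahler measure of \<open>g\<close>. So \<open>t\<close> has at most half the degree of \<open>\<alpha>\<close> without larger Mahler measure.\<close>

lemma class_power_sum_descent:
  assumes g: "minpoly_of \<alpha> g" and a0: "\<alpha> \<noteq> 0" and N: "N > 0"
    and b: "poly (ic g) \<beta> = 0" "\<beta> \<noteq> \<alpha>" "\<alpha> ^ N = \<beta> ^ N"
  obtains k c r where "0 < k" "k \<le> degree g" "c \<in> unity_sums N k" "c \<noteq> 0"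
    "minpoly_of (\<alpha> ^ k * c) r" "2 * degree r \<le> degree g"
    "mahler_measure r \<le> real (degree g) ^ degree g * mahler_measure g"
proof -
  define d where "d = degree g"
  define Z where "Z = roots g"
  define C where "C = power_class g N"
  define Ws where "Ws = (\<lambda>z. z ^ N) ` Z"
  have fin: "finite Z" unfolding Z_def by (rule minpoly_roots_finite[OF g])
  have cardZ: "card Z = d" unfolding Z_def d_def by (rule minpoly_card_roots[OF g])
  have finC: "finite (C w)" for w unfolding C_def power_class_def using fin by (simp add: Z_def)
  have finW: "finite Ws" using fin by (simp add: Ws_def)
  have aZ: "\<alpha> \<in> Z" using g by (simp add: Z_def minpoly_of_def)
  have aC: "\<alpha> \<in> C (\<alpha> ^ N)" using aZ by (simp add: C_def power_class_def Z_def)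
  have d0: "d > 0" unfolding d_def using g by (rule minpoly_degree_pos)
  have nz: "z \<noteq> 0" if "z \<in> Z" for z
  proof
    assume "z = 0"
    then have "minpoly_of 0 g" using minpoly_conjugate[OF g] that by (simp add: Z_def)
    from minpoly_root_transfer[OF this, of "[:0, 1:]" \<alpha>] g a0 show False
      by (simp add: minpoly_of_def map_poly_pCons)
  qed
  define s where "s = card (C (\<alpha> ^ N))"
  have card_C: "card (C w) = s" if "w \<in> Ws" for w
    using that card_power_class_constant[OF g] by (auto simp: Ws_def s_def C_def Z_def)
  have "{\<alpha>, \<beta>} \<subseteq> C (\<alpha> ^ N)" using aC b by (auto simp: C_def power_class_def)
  then have "card {\<alpha>, \<beta>} \<le> s" unfolding s_def by (intro card_mono finC)
  then have s2: "s \<ge> 2" using b(2) by simp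
  have fib: "C w = {z \<in> Z. z ^ N = w}" for w by (auto simp: C_def power_class_def Z_def)
  have dsum: "d = s * card Ws"
  proof -
    have "card Z = (\<Sum>w\<in>Ws. card {z \<in> Z. z ^ N = w})"
      using fin unfolding Ws_def card_eq_sum by (rule sum.image_gen)
    also have "\<dots> = (\<Sum>w\<in>Ws. s)" using card_C by (intro sum.cong refl) (simp flip: fib)
    finally show ?thesis using cardZ by simp
  qed
  then have "Ws \<noteq> {}" "s \<le> d" "card Ws \<le> d" using d0 s2 by auto
  have ne: "C (\<alpha> ^ N) \<noteq> {}" "\<And>y. y \<in> C (\<alpha> ^ N) \<Longrightarrow> y \<noteq> 0" using aC nz by (auto simp: fib)
  obtain k where k: "0 < k" "k \<le> s" "(\<Sum>y\<in>C (\<alpha> ^ N). y ^ k) \<noteq> 0"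
    using exists_nonzero_power_sum[of "C (\<alpha> ^ N)" "\<lambda>y. y", OF finC ne] unfolding s_def by blast
  define T where "T = (\<lambda>w. \<Sum>y\<in>C w. y ^ k)"
  \<comment> \<open>Members of a class have equal \<open>N\<close>-th powers, so division by
    \<alpha> turns the class into a set of \<open>N\<close>-th roots of unity.\<close>
  define Y where "Y = (\<lambda>y. y / \<alpha>) ` C (\<alpha> ^ N)"
  define c where "c = (\<Sum>u\<in>Y. u ^ k)"
  have "c = (\<Sum>y\<in>C (\<alpha> ^ N). (y / \<alpha>) ^ k)"
    unfolding c_def Y_def using a0 by (subst sum.reindex) (auto simp: inj_on_def)
  then have Tc: "T (\<alpha> ^ N) = \<alpha> ^ k * c"
    using a0 by (simp add: T_def sum_distrib_left power_divide)
  have "Y \<subseteq> {u. u ^ N = 1}" using a0 by (auto simp: Y_def fib power_divide)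
  then have c_mem: "c \<in> unity_sums N k" by (auto simp: c_def unity_sums_def)
  have c0: "c \<noteq> 0" using k(3) Tc by (auto simp: T_def)
  have "algebraic_int y" if "y \<in> Z" for y
    using that g by (auto simp: Z_def algebraic_int_altdef_ipoly minpoly_of_def)
  then have "algebraic_int (T (\<alpha> ^ N))"
    unfolding T_def by (intro algebraic_int_sum algebraic_int_power) (auto simp: fib)
  then obtain r where r: "minpoly_of (T (\<alpha> ^ N)) r" by (rule minpoly_exists)
  have finr: "finite (roots r)" by (rule minpoly_roots_finite[OF r])
  \<comment> \<open>The product of X - T (z ^ N) over all conjugates z is rational and vanishes at
    \<open>T (\<alpha> ^ N)\<close>, so each conjugate of that number is the power sum of some
    class.\<close>
  have sub: "roots r \<subseteq> T ` Ws"
  proof -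
    obtain P where P: "\<And>z. z \<in> roots g \<Longrightarrow> (\<Sum>y\<in>power_class g N (z ^ N). y ^ k) = poly (rp P) z"
      using class_power_sum_poly[OF g, where N = N and k = k] by blast
    then have P: "\<And>z. z \<in> Z \<Longrightarrow> T (z ^ N) = poly (rp P) z" by (simp add: Z_def T_def C_def)
    have "rational_coeffs (\<Prod>z\<in>Z. [:- poly (rp P) z, 1:])"
      using rational_coeffs_prod_image[OF fin, of "\<lambda>z. z" P]
      unfolding Z_def minpoly_eq_prod_roots[OF g, symmetric] by simp
    then obtain t where t: "(\<Prod>z\<in>Z. [:- poly (rp P) z, 1:]) = rp t" by (rule rational_coeffsE)
    have root: "poly (rp t) x = 0 \<longleftrightarrow> (\<exists>z\<in>Z. x = T (z ^ N))" for x
      unfolding t[symmetric] poly_prod using fin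
      by (subst prod_zero_iff) (auto simp: P)
    have "poly (rp t) (T (\<alpha> ^ N)) = 0" unfolding root using aZ by blast
    then have "poly (rp t) y = 0" if "y \<in> roots r" for y using minpoly_root_transfer[OF r] that by blast
    then show ?thesis unfolding root Ws_def by blast
  qed
  have "degree r = card (roots r)" using minpoly_card_roots[OF r] by simp
  also have "\<dots> \<le> card (T ` Ws)" using sub finW by (intro card_mono) auto
  also have "\<dots> \<le> card Ws" by (rule card_image_le[OF finW])
  finally have "2 * degree r \<le> 2 * card Ws" by simp
  also have "\<dots> \<le> d" unfolding dsum using s2 by (rule mult_right_mono) simp
  finally have deg: "2 * degree r \<le> d" .
  have bound: "max 1 (cmod (T w)) \<le> real d * (\<Prod>z\<in>C w. max 1 (cmod z))" if w: "w \<in> Ws" for w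
  proof -
    obtain z where z: "z \<in> Z" "w = z ^ N" using w by (auto simp: Ws_def)
    define m where "m = max 1 (cmod z)"
    have m1: "m \<ge> 1" by (simp add: m_def)
    have nrm: "cmod y = cmod z" if "y \<in> C w" for y
    proof -
      have "cmod y ^ N = cmod z ^ N" using that z by (simp add: fib flip: norm_power)
      then show ?thesis using N power_eq_iff_eq_base[of N "cmod y" "cmod z"] by simp
    qed
    have "cmod (T w) \<le> (\<Sum>y\<in>C w. cmod (y ^ k))" unfolding T_def by (rule norm_sum)
    also have "\<dots> = real s * cmod z ^ k" using card_C[OF w] by (simp add: norm_power nrm)
    also have "\<dots> \<le> real d * m ^ s"
    proof (intro mult_mono)
      have "cmod z ^ k \<le> m ^ k" by (intro power_mono) (auto simp: m_def)
      also have "\<dots> \<le> m ^ s" using k(2) m1 by (rule power_increasing)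
      finally show "cmod z ^ k \<le> m ^ s" .
    qed (use \<open>s \<le> d\<close> in auto)
    finally have "cmod (T w) \<le> real d * m ^ s" .
    moreover have "1 * 1 \<le> real d * m ^ s" using d0 m1 by (intro mult_mono one_le_power) auto
    moreover have "(\<Prod>z\<in>C w. max 1 (cmod z)) = m ^ s" using card_C[OF w] by (simp add: nrm m_def)
    ultimately show ?thesis by simp
  qed
  have "mahler_measure r = (\<Prod>t\<in>roots r. max 1 (cmod t))" by (rule mahler_minpoly[OF r])
  also have "\<dots> \<le> (\<Prod>w\<in>Ws. max 1 (cmod (T w)))"
  proof -
    \<comment> \<open>Different classes may have the same power sum. \<open>e\<close> selects one
      class for each conjugate, and the factors of the unselected classes are at least 1.\<close>
    define e where "e = inv_into Ws T"
    have e: "e t \<in> Ws" "T (e t) = t" if "t \<in> roots r" for t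
      using sub that unfolding e_def by (auto intro: inv_into_into f_inv_into_f)
    have "(\<Prod>t\<in>roots r. max 1 (cmod t)) = (\<Prod>w\<in>e ` roots r. max 1 (cmod (T w)))"
    proof -
      have "inj_on e (roots r)" using e(2) by (rule inj_on_inverseI)
      then show ?thesis using e(2) by (simp add: prod.reindex)
    qed
    also have "\<dots> \<le> (\<Prod>w\<in>Ws. max 1 (cmod (T w)))"
      using e(1) by (intro prod_mono2 finW) auto
    finally show ?thesis .
  qed
  also have "\<dots> \<le> (\<Prod>w\<in>Ws. real d * (\<Prod>z\<in>C w. max 1 (cmod z)))"
    by (rule prod_mono, rule conjI) (simp, rule bound)
  also have "\<dots> = real d ^ card Ws * (\<Prod>z\<in>Z. max 1 (cmod z))"
  proof -
    have "(\<Prod>z\<in>Z. max 1 (cmod z)) = (\<Prod>w\<in>Ws. \<Prod>z\<in>C w. max 1 (cmod z))"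
      unfolding fib Ws_def by (rule prod.image_gen[OF fin])
    then show ?thesis by (simp add: prod.distrib)
  qed
  also have "(\<Prod>z\<in>Z. max 1 (cmod z)) = mahler_measure g" unfolding Z_def by (rule mahler_minpoly[OF g, symmetric])
  also have "real d ^ card Ws * mahler_measure g \<le> real d ^ d * mahler_measure g"
    using d0 \<open>card Ws \<le> d\<close> by (intro mult_right_mono power_increasing mahler_measure_ge_0) auto
  finally have mah: "mahler_measure r \<le> real d ^ d * mahler_measure g" .
  show ?thesis
    by (rule that[of k c r]) (use k \<open>s \<le> d\<close> c_mem c0 r deg mah in \<open>auto simp: d_def Tc\<close>)
qed

section \<open>Upper bounds\<close>

text \<open>A junk value unless \<open>x\<close> is an algebraic integer.\<close>

definition min_poly :: "complex \<Rightarrow> int poly" where "min_poly x = (THE g. minpoly_of x g)"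

lemma min_poly_eqI: "minpoly_of x g \<Longrightarrow> min_poly x = g"
  unfolding min_poly_def using minpoly_unique by blast

definition joint_minpoly :: "complex \<Rightarrow> complex \<Rightarrow> int poly" where
  "joint_minpoly \<alpha> \<beta> = (if min_poly \<alpha> = min_poly \<beta> then min_poly \<alpha> else min_poly \<alpha> * min_poly \<beta>)"

lemma minpoly_nonzero: "minpoly_of x g \<Longrightarrow> g \<noteq> 0"
  by (auto simp: minpoly_of_def)

lemma int_root_minpoly:
  assumes "lead_coeff f = 1" "poly (ic f) x = 0"
  shows "minpoly_of x (min_poly x)"
proof -
  have "algebraic_int x" using assms by (auto simp: algebraic_int_altdef_ipoly)
  then obtain g where "minpoly_of x g" by (rule minpoly_exists)
  then show ?thesis using min_poly_eqI by blast
qed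

lemma joint_minpoly_props:
  assumes f: "lead_coeff f = 1" and a: "poly (ic f) \<alpha> = 0" and b: "poly (ic f) \<beta> = 0" and ab: "\<alpha> \<noteq> \<beta>"
  defines "F \<equiv> joint_minpoly \<alpha> \<beta>"
  shows "lead_coeff F = 1" "F dvd f" "poly (ic F) \<alpha> = 0" "poly (ic F) \<beta> = 0" "degree F \<ge> 2"
proof -
  have ga: "minpoly_of \<alpha> (min_poly \<alpha>)" by (rule int_root_minpoly[OF f a])
  have gb: "minpoly_of \<beta> (min_poly \<beta>)" by (rule int_root_minpoly[OF f b])
  show "lead_coeff F = 1" using ga gb by (auto simp: F_def joint_minpoly_def minpoly_of_def lead_coeff_mult)
  show "poly (ic F) \<alpha> = 0" "poly (ic F) \<beta> = 0"
    using ga gb by (auto simp: F_def joint_minpoly_def minpoly_of_def of_int_poly_hom.hom_mult)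
  have da: "min_poly \<alpha> dvd f" by (rule minpoly_dvd_int[OF ga a])
  show "F dvd f"
  proof (cases "min_poly \<alpha> = min_poly \<beta>")
    case True
    then show ?thesis using da by (simp add: F_def joint_minpoly_def)
  next
    case False
    \<comment> \<open>Distinct minimal polynomials share no root, so \<beta> is a root of the
      cofactor \<open>q\<close>.\<close>
    obtain q where q: "f = min_poly \<alpha> * q" using da by (auto simp: dvd_def)
    have "poly (ic (min_poly \<alpha>)) \<beta> \<noteq> 0"
      using minpoly_unique[OF minpoly_conjugate[OF ga] gb] False by blast
    then have "poly (ic q) \<beta> = 0" using b by (simp add: q of_int_poly_hom.hom_mult)
    then have "min_poly \<beta> dvd q" by (rule minpoly_dvd_int[OF gb])
    then show ?thesis using False by (simp add: F_def joint_minpoly_def q)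
  qed
  show "degree F \<ge> 2"
  proof (cases "min_poly \<alpha> = min_poly \<beta>")
    case True
    have "{\<alpha>, \<beta>} \<subseteq> roots (min_poly \<alpha>)" using ga gb True by (auto simp: minpoly_of_def)
    then have "card {\<alpha>, \<beta>} \<le> card (roots (min_poly \<alpha>))" by (intro card_mono minpoly_roots_finite[OF ga])
    then show ?thesis using ab minpoly_card_roots[OF ga] True by (simp add: F_def joint_minpoly_def)
  next
    case False
    then have "degree F = degree (min_poly \<alpha>) + degree (min_poly \<beta>)"
      using degree_mult_eq[OF minpoly_nonzero[OF ga] minpoly_nonzero[OF gb]]
      by (simp add: F_def joint_minpoly_def)
    then show ?thesis using minpoly_degree_pos[OF ga] minpoly_degree_pos[OF gb] by simp
  qed
qed

text \<open>The numbers \<open>\<alpha>\<close> that can be recovered from a class power sum \<open>t = \<alpha> ^ k * c\<close> of degree at most \<open>e\<close>;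
  the numbers of degree at most \<open>e\<close> themselves arise for \<open>k = c = 1\<close>.\<close>

definition descent_set :: "nat \<Rightarrow> nat \<Rightarrow> nat \<Rightarrow> real \<Rightarrow> complex set" where
  "descent_set n N e B = (\<Union>d\<in>{..e}. \<Union>r\<in>monic_mahler d B. \<Union>t\<in>roots r. \<Union>k\<in>{1..n}. \<Union>c\<in>unity_sums N k - {0}.
     {\<alpha>. \<alpha> ^ k * c = t})"

lemma descent_setI:
  assumes "r \<in> monic_mahler d B" "d \<le> e" "poly (ic r) (\<alpha> ^ k * c) = 0" "1 \<le> k" "k \<le> n" "c \<in> unity_sums N k" "c \<noteq> 0"
  shows "\<alpha> \<in> descent_set n N e B"
  using assms unfolding descent_set_def by (intro UN_I[of d] UN_I[of r] UN_I[of "\<alpha> ^ k * c"] UN_I[of k] UN_I[of c]) auto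

lemma degenerate_pair_cover:
  assumes f: "lead_coeff f = 1" "degree f = n" and B: "mahler_measure f \<le> B"
    and a: "poly (ic f) \<alpha> = 0" and b: "poly (ic f) \<beta> = 0" and ab: "\<alpha> \<noteq> \<beta>"
    and nz: "\<alpha> \<noteq> 0" "\<beta> \<noteq> 0" and N: "N > 0" "\<alpha> ^ N = \<beta> ^ N"
    and D: "degree (joint_minpoly \<alpha> \<beta>) \<ge> 3"
    and le: "degree (min_poly \<alpha>) \<le> degree (min_poly \<beta>)"
  shows "\<alpha> \<in> descent_set n N (degree (joint_minpoly \<alpha> \<beta>) - 2) (real n ^ n * B)"
proof -
  define F where "F = joint_minpoly \<alpha> \<beta>"
  have ga: "minpoly_of \<alpha> (min_poly \<alpha>)" by (rule int_root_minpoly[OF f(1) a])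
  have gb: "minpoly_of \<beta> (min_poly \<beta>)" by (rule int_root_minpoly[OF f(1) b])
  note F = joint_minpoly_props[OF f(1) a b ab, folded F_def]
  have f0: "f \<noteq> 0" using f(1) by auto
  have degF: "degree F \<le> n" using dvd_imp_degree_le[OF F(2) f0] f(2) by simp
  have da: "min_poly \<alpha> dvd f" by (rule minpoly_dvd_int[OF ga a])
  have ma: "mahler_measure (min_poly \<alpha>) \<le> B" using mahler_measure_dvd[OF f0 da] B by simp
  have dn: "degree (min_poly \<alpha>) \<le> n" using dvd_imp_degree_le[OF da f0] f(2) by simp
  have n1: "1 \<le> real n" using D degF by (simp add: F_def)
  have B0: "0 \<le> B" using ma mahler_measure_ge_0[of "min_poly \<alpha>"] by simp
  have nn: "B \<le> real n ^ n * B"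
    using mult_right_mono[OF one_le_power[OF n1, of n] B0] by simp
  show ?thesis unfolding F_def[symmetric]
  proof (cases "min_poly \<alpha> = min_poly \<beta>")
    case True
    then have Fa: "F = min_poly \<alpha>" by (simp add: F_def joint_minpoly_def)
    have rb: "poly (ic (min_poly \<alpha>)) \<beta> = 0" using gb True by (simp add: minpoly_of_def)
    obtain k c r where kcr: "0 < k" "k \<le> degree (min_poly \<alpha>)" "c \<in> unity_sums N k" "c \<noteq> 0"
      "minpoly_of (\<alpha> ^ k * c) r" "2 * degree r \<le> degree (min_poly \<alpha>)"
      "mahler_measure r \<le> real (degree (min_poly \<alpha>)) ^ degree (min_poly \<alpha>) * mahler_measure (min_poly \<alpha>)"
      using class_power_sum_descent[OF ga nz(1) N(1) rb ab[symmetric] N(2)] by blast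
    have "real (degree (min_poly \<alpha>)) ^ degree (min_poly \<alpha>) \<le> real n ^ degree (min_poly \<alpha>)"
      using dn by (intro power_mono) auto
    also have "\<dots> \<le> real n ^ n" using dn n1 by (rule power_increasing)
    finally have "real (degree (min_poly \<alpha>)) ^ degree (min_poly \<alpha>) * mahler_measure (min_poly \<alpha>) \<le> real n ^ n * B"
      using ma by (intro mult_mono) (auto simp: mahler_measure_ge_0)
    with kcr(7) have "mahler_measure r \<le> real n ^ n * B" by simp
    then have "r \<in> monic_mahler (degree r) (real n ^ n * B)" using kcr(5) by (simp add: monic_mahler_def minpoly_of_def)
    \<comment> \<open>From 2 * degree r \<le> D and D \<ge> 3 it follows that degree r \<le> D - 2,
      where D is the degree of \<open>F\<close>.\<close>
    then show "\<alpha> \<in> descent_set n N (degree F - 2) (real n ^ n * B)"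
      by (rule descent_setI) (use kcr D dn Fa in \<open>auto simp: minpoly_of_def F_def\<close>)
  next
    case False
    then have Fab: "F = min_poly \<alpha> * min_poly \<beta>" by (simp add: F_def joint_minpoly_def)
    then have dF: "degree F = degree (min_poly \<alpha>) + degree (min_poly \<beta>)"
      using degree_mult_eq[OF minpoly_nonzero[OF ga] minpoly_nonzero[OF gb]] by simp
    \<comment> \<open>The two degrees add up to at least 3, so the larger one is at least 2, and
      \<open>min_poly \<alpha>\<close> has degree at most \<open>degree F - 2\<close>.\<close>
    have mem: "min_poly \<alpha> \<in> monic_mahler (degree (min_poly \<alpha>)) (real n ^ n * B)"
      using ga ma nn by (simp add: monic_mahler_def minpoly_of_def)
    have one: "(1::complex) \<in> unity_sums N 1"
      unfolding unity_sums_def by (intro image_eqI[of _ _ "{1}"]) auto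
    show "\<alpha> \<in> descent_set n N (degree F - 2) (real n ^ n * B)"
      by (rule descent_setI[OF mem _ _ _ _ one]) (use ga dF D le n1 in \<open>auto simp: minpoly_of_def F_def\<close>)
  qed
qed

lemma card_scaled_roots:
  assumes "k > 0" "c \<noteq> 0"
  shows "finite {\<alpha> :: complex. \<alpha> ^ k * c = t}" "card {\<alpha> :: complex. \<alpha> ^ k * c = t} \<le> k"
proof -
  define p where "p = Polynomial.monom c k - [:t:]"
  have cf: "poly.coeff p k = c" using assms(1) by (simp add: p_def coeff_pCons split: nat.split)
  then have p0: "p \<noteq> 0" using assms(2) by auto
  have eq: "{\<alpha>. \<alpha> ^ k * c = t} = {\<alpha>. poly p \<alpha> = 0}" by (simp add: p_def poly_monom mult.commute)
  show "finite {\<alpha> :: complex. \<alpha> ^ k * c = t}" unfolding eq using p0 by (rule poly_roots_finite)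
  have "degree p \<le> k" unfolding p_def by (intro degree_diff_le degree_monom_le) auto
  then show "card {\<alpha> :: complex. \<alpha> ^ k * c = t} \<le> k"
    unfolding eq using card_poly_roots_bound[OF p0] by linarith
qed

lemma card_UN_le_mult:
  assumes "finite I" "\<And>i. i \<in> I \<Longrightarrow> card (A i) \<le> m"
  shows "card (\<Union>i\<in>I. A i) \<le> card I * m"
proof -
  have "card (\<Union>i\<in>I. A i) \<le> (\<Sum>i\<in>I. card (A i))" by (rule card_UN_le[OF assms(1)])
  also have "\<dots> \<le> (\<Sum>i\<in>I. m)" using assms(2) by (rule sum_mono)
  finally show ?thesis by simp
qed

lemma descent_set_bound:
  assumes N: "N > 0" and n: "n > 0"
  obtains K :: real where "K > 0" "\<And>e B. e \<le> n \<Longrightarrow> B \<ge> 1 \<Longrightarrow> finite (descent_set n N e B) \<and>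
     real (card (descent_set n N e B)) \<le> K * B ^ e"
proof -
  define U where "U = (\<Union>k\<in>{1..n}. unity_sums N k)"
  have finU: "finite U" unfolding U_def using finite_unity_sums[OF N] by blast
  \<comment> \<open>The four factors bound, for one polynomial \<open>r\<close>, the number of its
    roots \<open>t\<close>, of exponents \<open>k\<close>, of constants \<open>c\<close>, and of
    solutions of \<open>\<alpha> ^ k * c = t\<close>.\<close>
  define q where "q = n * (n * (card U * n))"
  define K where "K = real (n + 1) * (2 ^ (n + 2)) ^ n * real (q + 1)"
  show ?thesis
  proof (rule that[of K])
    show "K > 0" by (simp add: K_def)
    fix e :: nat and B :: real assume e: "e \<le> n" and B: "B \<ge> 1"
    define A where "A = (\<lambda>t. \<Union>k\<in>{1..n}. \<Union>c\<in>unity_sums N k - {0}. {\<alpha> :: complex. \<alpha> ^ k * c = t})"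
    have finA: "finite (A t)" for t
      unfolding A_def using finite_unity_sums[OF N] card_scaled_roots(1) by auto
    have cardA: "card (A t) \<le> n * (card U * n)" for t
    proof -
      have "card (A t) \<le> card {1..n} * (card U * n)" unfolding A_def
      proof (rule card_UN_le_mult)
        fix k assume k: "k \<in> {1..n}"
        have "card (\<Union>c\<in>unity_sums N k - {0}. {\<alpha> :: complex. \<alpha> ^ k * c = t}) \<le> card (unity_sums N k - {0}) * n"
        proof (rule card_UN_le_mult)
          fix c assume "c \<in> unity_sums N k - {0}"
          then show "card {\<alpha> :: complex. \<alpha> ^ k * c = t} \<le> n"
            using card_scaled_roots(2)[of k c t] k by auto
        qed (use finite_unity_sums[OF N] in auto)
        also have "card (unity_sums N k - {0}) \<le> card U"
          by (rule card_mono[OF finU]) (use k in \<open>auto simp: U_def\<close>)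
        finally show "card (\<Union>c\<in>unity_sums N k - {0}. {\<alpha> :: complex. \<alpha> ^ k * c = t}) \<le> card U * n"
          by simp
      qed simp
      then show ?thesis by simp
    qed
    have ds: "descent_set n N e B = (\<Union>d\<in>{..e}. \<Union>r\<in>monic_mahler d B. \<Union>t\<in>roots r. A t)"
      by (simp add: descent_set_def A_def)
    have finr: "finite (roots r)" if "r \<in> monic_mahler d B" for r d
      using that by (intro poly_roots_finite) (auto simp: monic_mahler_def)
    have fin: "finite (descent_set n N e B)" unfolding ds using finite_monic_mahler finr finA by blast
    have q1: "card (\<Union>t\<in>roots r. A t) \<le> q" if r: "r \<in> monic_mahler d B" "d \<le> e" for r d
    proof -
      have "card (roots r) \<le> degree (ic r)" using r by (intro card_poly_roots_bound) (auto simp: monic_mahler_def)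
      also have "\<dots> \<le> n" using r e by (auto simp: monic_mahler_def)
      finally have "card (roots r) \<le> n" .
      moreover have "card (\<Union>t\<in>roots r. A t) \<le> card (roots r) * (n * (card U * n))"
        using finr[OF r(1)] cardA by (rule card_UN_le_mult)
      ultimately show ?thesis unfolding q_def by (meson mult_le_mono1 order_trans)
    qed
    have "real (card (descent_set n N e B)) \<le> (\<Sum>d\<in>{..e}. real (card (\<Union>r\<in>monic_mahler d B. \<Union>t\<in>roots r. A t)))"
      unfolding ds of_nat_sum[symmetric] of_nat_le_iff by (rule card_UN_le) simp
    also have "\<dots> \<le> (\<Sum>d\<in>{..e}. (2 ^ (n + 2)) ^ n * real (q + 1) * B ^ e)"
    proof (rule sum_mono)
      fix d assume d: "d \<in> {..e}"
      have "real (card (\<Union>r\<in>monic_mahler d B. \<Union>t\<in>roots r. A t)) \<le> real (card (monic_mahler d B) * q)"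
        unfolding of_nat_le_iff using d by (intro card_UN_le_mult finite_monic_mahler q1) auto
      also have "\<dots> = real (card (monic_mahler d B)) * real q" by simp
      also have "\<dots> \<le> (2 ^ (d + 2) * B) ^ d * real q"
        by (intro mult_right_mono card_monic_mahler B) simp
      also have "\<dots> = (2 ^ (d + 2)) ^ d * B ^ d * real q" by (simp only: power_mult_distrib)
      also have "\<dots> \<le> (2 ^ (n + 2)) ^ n * B ^ e * real (q + 1)"
      proof (intro mult_mono)
        have "((2::real) ^ (d + 2)) ^ d \<le> (2 ^ (n + 2)) ^ d" using d e by (intro power_mono power_increasing) auto
        also have "\<dots> \<le> (2 ^ (n + 2)) ^ n" using d e by (intro power_increasing one_le_power) auto
        finally show "((2::real) ^ (d + 2)) ^ d \<le> (2 ^ (n + 2)) ^ n" .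
        show "B ^ d \<le> B ^ e" using d B by (intro power_increasing) auto
      qed (use B in auto)
      finally show "real (card (\<Union>r\<in>monic_mahler d B. \<Union>t\<in>roots r. A t)) \<le> (2 ^ (n + 2)) ^ n * real (q + 1) * B ^ e"
        by (simp only: mult_ac)
    qed
    also have "\<dots> = real (e + 1) * ((2 ^ (n + 2)) ^ n * real (q + 1) * B ^ e)" by simp
    also have "\<dots> \<le> real (n + 1) * ((2 ^ (n + 2)) ^ n * real (q + 1) * B ^ e)"
      using e B by (intro mult_right_mono) auto
    also have "\<dots> = K * B ^ e" unfolding K_def by (simp only: mult_ac)
    finally show "finite (descent_set n N e B) \<and> real (card (descent_set n N e B)) \<le> K * B ^ e"
      using fin by blast
  qed
qed

text \<open>Vieta's formula for a monic quadratic. The bound on \<open>c\<close> is Mignotte's bound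
  for the constant coefficient, where the binomial factor is 1.\<close>

lemma joint_minpoly_quadratic:
  assumes f: "lead_coeff f = 1" and a: "poly (ic f) \<alpha> = 0" and b: "poly (ic f) \<beta> = 0" and ab: "\<alpha> \<noteq> \<beta>"
    and D: "degree (joint_minpoly \<alpha> \<beta>) = 2"
  defines "c \<equiv> poly.coeff (joint_minpoly \<alpha> \<beta>) 0"
  shows "\<alpha> * \<beta> = of_int c" "of_int \<bar>c\<bar> \<le> mahler_measure (joint_minpoly \<alpha> \<beta>)"
proof -
  define F where "F = joint_minpoly \<alpha> \<beta>"
  note F = joint_minpoly_props[OF f a b ab, folded F_def]
  define b1 where "b1 = poly.coeff F 1"
  have c: "c = poly.coeff F 0" by (simp add: c_def F_def)
  have F2: "poly.coeff F 2 = 1" using F(1) D by (simp add: F_def)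
  have "poly (ic F) x = of_int c + of_int b1 * x + x\<^sup>2" for x
    unfolding poly_altdef using D F2 by (simp add: F_def[symmetric] c b1_def numeral_2_eq_2)
  then have e: "of_int c + of_int b1 * \<alpha> + \<alpha>\<^sup>2 = 0" "of_int c + of_int b1 * \<beta> + \<beta>\<^sup>2 = 0" using F(3,4) by auto
  have "(\<alpha> - \<beta>) * (of_int b1 + \<alpha> + \<beta>)
      = (of_int c + of_int b1 * \<alpha> + \<alpha>\<^sup>2) - (of_int c + of_int b1 * \<beta> + \<beta>\<^sup>2)"
    by (simp add: algebra_simps power2_eq_square)
  also have "\<dots> = 0" unfolding e by simp
  finally have "of_int b1 + \<alpha> + \<beta> = 0" using ab by simp
  then have b1: "of_int b1 = - \<alpha> - \<beta>" by (simp add: algebra_simps eq_neg_iff_add_eq_0)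
  have "\<alpha> * \<beta> = of_int c - (of_int c + of_int b1 * \<alpha> + \<alpha>\<^sup>2)"
    unfolding b1 by (simp add: algebra_simps power2_eq_square)
  then show "\<alpha> * \<beta> = of_int c" unfolding e(1) by simp
  show "of_int \<bar>c\<bar> \<le> mahler_measure (joint_minpoly \<alpha> \<beta>)"
    using Mignotte_bound[of F 0] by (simp add: c F_def)
qed

text \<open>The relation between the roots is symmetric, so they can be swapped to order the
  degrees. Neither is 0, since then the quotient would be 0.\<close>

lemma degenerate_normal_form:
  assumes f: "lead_coeff f = 1" "degenerate (ic f)"
  obtains \<alpha> \<beta> k where "poly (ic f) \<alpha> = 0" "poly (ic f) \<beta> = 0" "\<alpha> \<noteq> \<beta>" "\<alpha> \<noteq> 0" "\<beta> \<noteq> 0"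
    "k > (0::nat)" "(\<alpha> / \<beta>) ^ k = 1" "degree (min_poly \<alpha>) \<le> degree (min_poly \<beta>)"
proof -
  obtain \<alpha> \<beta> k where *: "poly (ic f) \<alpha> = 0" "poly (ic f) \<beta> = 0" "\<alpha> \<noteq> \<beta>" "k > 0" "(\<alpha> / \<beta>) ^ k = 1"
    using f(2) unfolding degenerate_def by blast
  then have nz: "\<alpha> \<noteq> 0" "\<beta> \<noteq> 0" by (auto simp: power_0_left)
  have "(\<beta> / \<alpha>) ^ k = 1"
    using *(5) nz by (simp add: power_divide)
  then show ?thesis using that[of \<alpha> \<beta> k] that[of \<beta> \<alpha> k] * nz by (metis nat_le_linear)
qed

lemma S_mahler:
  assumes "f \<in> S n H" "H \<ge> 1"
  shows "mahler_measure f \<le> real ((n + 1) * H)"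
proof -
  have f: "degree f = n" "lead_coeff f = 1" "\<forall>j\<in>{1..n}. \<bar>poly.coeff f (n - j)\<bar> \<le> int H"
    using assms by (auto simp: S_def)
  have "\<bar>poly.coeff f k\<bar> \<le> int H" for k
  proof -
    consider "k < n" | "k = n" | "k > n" by linarith
    then show ?thesis
    proof cases
      case 1
      then show ?thesis using f(3)[rule_format, of "n - k"] by simp
    qed (use f assms in \<open>auto simp: coeff_eq_0\<close>)
  qed
  then have "mahler_measure f \<le> real (degree f + 1) * real H" by (rule mahler_measure_le_height)
  then show ?thesis using f(1) by (simp add: distrib_right)
qed

text \<open>Candidates for \<open>f = G * h\<close> with \<open>G\<close> the joint minimal polynomial of the roots \<open>\<alpha>\<close> and \<open>u * \<alpha>\<close>: here
  \<open>G\<close> has degree \<open>D \<ge> 3\<close>, and in \<open>deg_two\<close> it is quadratic with constant term \<open>c\<close>.\<close>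

definition deg_large :: "nat \<Rightarrow> nat \<Rightarrow> real \<Rightarrow> nat \<Rightarrow> int poly set" where
  "deg_large n N B D = (\<lambda>(\<alpha>, u, h). joint_minpoly \<alpha> (u * \<alpha>) * h) `
     (descent_set n N (D - 2) (real n ^ n * B) \<times> {u. u ^ N = 1} \<times> monic_mahler (n - D) B)"

definition deg_two :: "nat \<Rightarrow> nat \<Rightarrow> real \<Rightarrow> int \<Rightarrow> int poly set" where
  "deg_two n N B c = (\<Union>u\<in>{u. u ^ N = 1}. (\<lambda>(\<alpha>, h). joint_minpoly \<alpha> (u * \<alpha>) * h) `
     ({\<alpha>. \<alpha> ^ 2 * u = of_int c} \<times> monic_mahler (n - 2) (B / of_int \<bar>c\<bar>)))"

lemma S_cover:
  assumes N: "N > 0"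
    "\<And>f \<alpha> \<beta> k. lead_coeff f = 1 \<Longrightarrow> degree f = n \<Longrightarrow> poly (ic f) \<alpha> = 0 \<Longrightarrow> poly (ic f) \<beta> = 0 \<Longrightarrow>
       \<beta> \<noteq> 0 \<Longrightarrow> k > 0 \<Longrightarrow> (\<alpha> / \<beta>) ^ k = 1 \<Longrightarrow> \<alpha> ^ N = \<beta> ^ N"
    and H: "H \<ge> 1"
  defines "b \<equiv> (n + 1) * H"
  shows "S n H \<subseteq> (\<Union>D\<in>{3..n}. deg_large n N (real b) D) \<union>
    (\<Union>m\<in>{1..b}. deg_two n N (real b) (int m) \<union> deg_two n N (real b) (- int m))"
proof
  fix f assume fS: "f \<in> S n H"
  have f: "degree f = n" "lead_coeff f = 1" "degenerate (ic f)" using fS by (auto simp: S_def)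
  have mf: "mahler_measure f \<le> real b" using S_mahler[OF fS H] by (simp add: b_def)
  have f0: "f \<noteq> 0" using f by auto
  obtain \<alpha> \<beta> k where *: "poly (ic f) \<alpha> = 0" "poly (ic f) \<beta> = 0" "\<alpha> \<noteq> \<beta>" "\<alpha> \<noteq> 0" "\<beta> \<noteq> 0"
    "k > (0::nat)" "(\<alpha> / \<beta>) ^ k = 1" "degree (min_poly \<alpha>) \<le> degree (min_poly \<beta>)"
    using degenerate_normal_form[OF f(2,3)] by blast
  have pN: "\<alpha> ^ N = \<beta> ^ N" using N(2)[OF f(2,1) *(1,2,5,6,7)] .
  define F where "F = joint_minpoly \<alpha> \<beta>"
  note F = joint_minpoly_props[OF f(2) *(1,2,3), folded F_def]
  obtain h where h: "f = F * h" using F(2) by (auto simp: dvd_def)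
  have h0: "h \<noteq> 0" and F0: "F \<noteq> 0" using f0 h by auto
  have lh: "lead_coeff h = 1" using f(2) F(1) by (simp add: h lead_coeff_mult)
  have deg: "degree f = degree F + degree h" using degree_mult_eq[OF F0 h0] h by simp
  have mF: "mahler_measure F \<ge> 1" using F0 by (rule mahler_measure_poly_ge_1)
  have mh: "mahler_measure F * mahler_measure h \<le> real b" using mf by (simp add: h mahler_measure_mult)
  \<comment> \<open>Every lower bound for the measure of \<open>F\<close> improves the bound for
    \<open>h\<close>: it is applied with \<open>x = 1\<close> if \<open>F\<close> has degree at
    least 3, and with the absolute value of \<open>c\<close> if \<open>F\<close> is
    quadratic.\<close>
  have mhb: "mahler_measure h \<le> real b / x" if "0 < x" "x \<le> mahler_measure F" for x
  proof -
    have "x * mahler_measure h \<le> mahler_measure F * mahler_measure h"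
      using that by (intro mult_right_mono mahler_measure_ge_0)
    then show ?thesis using mh that(1) by (simp add: field_simps)
  qed
  define u where "u = \<beta> / \<alpha>"
  have u: "u ^ N = 1" "u * \<alpha> = \<beta>" using pN * by (auto simp: u_def power_divide)
  show "f \<in> (\<Union>D\<in>{3..n}. deg_large n N (real b) D) \<union>
    (\<Union>m\<in>{1..b}. deg_two n N (real b) (int m) \<union> deg_two n N (real b) (- int m))"
  proof (cases "degree F \<ge> 3")
    case True
    have "\<alpha> \<in> descent_set n N (degree F - 2) (real n ^ n * real b)"
      unfolding F_def
      by (rule degenerate_pair_cover[OF f(2,1) mf *(1-5) N(1) pN _ *(8)]) (use True in \<open>simp add: F_def\<close>)
    moreover have "h \<in> monic_mahler (n - degree F) (real b)"
      using lh deg f(1) mhb[of 1] mF by (simp add: monic_mahler_def)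
    ultimately have "f \<in> deg_large n N (real b) (degree F)"
      unfolding deg_large_def using u by (intro image_eqI[where x = "(\<alpha>, u, h)"]) (auto simp: h F_def)
    moreover have "degree F \<in> {3..n}" using True deg f(1) by simp
    ultimately show ?thesis by blast
  next
    case False
    then have D: "degree F = 2" using F(5) by simp
    define c where "c = poly.coeff F 0"
    note c = joint_minpoly_quadratic[OF f(2) *(1,2,3), folded F_def, OF D, folded c_def]
    have c0: "c \<noteq> 0" using c(1) * by auto
    have "of_int \<bar>c\<bar> \<le> real b"
    proof -
      have "mahler_measure F \<le> mahler_measure f" by (rule mahler_measure_dvd[OF f0 F(2)])
      then show ?thesis using c(2) mf by linarith
    qed
    then have cb: "nat \<bar>c\<bar> \<in> {1..b}" using c0 by (auto simp: nat_le_iff)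
    have "h \<in> monic_mahler (n - 2) (real b / of_int \<bar>c\<bar>)"
      using lh deg f(1) D mhb[of "of_int \<bar>c\<bar>"] c(2) c0 by (simp add: monic_mahler_def)
    \<comment> \<open>With \<beta> = u * \<alpha>, the integer \<open>c\<close> and the root of
      unity \<open>u\<close> determine \<alpha> up to sign.\<close>
    moreover have "\<alpha> ^ 2 * u = of_int c" using c(1) u(2) by (simp add: power2_eq_square mult_ac)
    ultimately have "f \<in> deg_two n N (real b) c"
      unfolding deg_two_def using u by (intro UN_I[of u] image_eqI[where x = "(\<alpha>, h)"]) (auto simp: h F_def)
    moreover have "c = int (nat \<bar>c\<bar>) \<or> c = - int (nat \<bar>c\<bar>)" by linarith
    ultimately have "f \<in> deg_two n N (real b) (int (nat \<bar>c\<bar>)) \<union> deg_two n N (real b) (- int (nat \<bar>c\<bar>))" by auto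
    with cb show ?thesis by blast
  qed
qed

lemma finite_card_roots_of_unity:
  assumes "N > 0" shows "finite {u :: complex. u ^ N = 1}" "card {u :: complex. u ^ N = 1} \<le> N"
  using card_scaled_roots[OF assms, of 1 1] by auto

text \<open>At most \<open>N\<close> values of \<open>u\<close>, two of \<alpha> for each, and then
  the choices of \<open>h\<close>. The bound of \<bar>c\<bar> by \<open>B\<close> keeps the measure
  bound \<open>B / of_int \<bar>c\<bar>\<close> at least 1, as \<open>card_monic_mahler\<close>
  requires.\<close>

lemma card_deg_two:
  assumes N: "N > 0" and n: "n \<ge> 2" and m: "0 < \<bar>c\<bar>" "of_int \<bar>c\<bar> \<le> B"
  shows "finite (deg_two n N B c)"
    "real (card (deg_two n N B c)) \<le> real (2 * N) * ((2 ^ n * B) ^ (n - 2) / of_int \<bar>c\<bar> ^ (n - 2))"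
proof -
  define M where "M = monic_mahler (n - 2) (B / of_int \<bar>c\<bar>)"
  have fin2: "finite {\<alpha> :: complex. \<alpha> ^ 2 * u = of_int c}" and card2: "card {\<alpha> :: complex. \<alpha> ^ 2 * u = of_int c} \<le> 2"
    if "u ^ N = 1" for u
  proof -
    have "u \<noteq> 0" using that N by (auto simp: power_0_left)
    then show "finite {\<alpha> :: complex. \<alpha> ^ 2 * u = of_int c}" "card {\<alpha> :: complex. \<alpha> ^ 2 * u = of_int c} \<le> 2"
      using card_scaled_roots[of 2 u "of_int c"] by auto
  qed
  have finM: "finite M" by (simp add: M_def finite_monic_mahler)
  show "finite (deg_two n N B c)"
    unfolding deg_two_def M_def[symmetric] using finite_card_roots_of_unity(1)[OF N] fin2 finM by auto
  have "card (deg_two n N B c) \<le> card {u :: complex. u ^ N = 1} * (2 * card M)"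
    unfolding deg_two_def M_def[symmetric]
  proof (rule card_UN_le_mult[OF finite_card_roots_of_unity(1)[OF N]])
    fix u :: complex assume "u \<in> {u. u ^ N = 1}"
    then have u: "u ^ N = 1" by simp
    have "card ((\<lambda>(\<alpha>, h). joint_minpoly \<alpha> (u * \<alpha>) * h) ` ({\<alpha>. \<alpha> ^ 2 * u = of_int c} \<times> M))
        \<le> card ({\<alpha>. \<alpha> ^ 2 * u = of_int c} \<times> M)"
      using fin2[OF u] finM by (intro card_image_le) auto
    also have "\<dots> \<le> 2 * card M" using card2[OF u] by (simp add: card_cartesian_product)
    finally show "card ((\<lambda>(\<alpha>, h). joint_minpoly \<alpha> (u * \<alpha>) * h) ` ({\<alpha>. \<alpha> ^ 2 * u = of_int c} \<times> M)) \<le> 2 * card M" .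
  qed
  also have "\<dots> \<le> N * (2 * card M)" using finite_card_roots_of_unity(2)[OF N] by simp
  finally have "real (card (deg_two n N B c)) \<le> real (N * (2 * card M))" by (simp only: of_nat_le_iff)
  also have "\<dots> = real (2 * N) * real (card M)" by simp
  also have "\<dots> \<le> real (2 * N) * (2 ^ (n - 2 + 2) * (B / of_int \<bar>c\<bar>)) ^ (n - 2)"
    unfolding M_def using m by (intro mult_left_mono card_monic_mahler) (simp_all add: field_simps)
  also have "n - 2 + 2 = n" using n by simp
  also have "(2 ^ n * (B / of_int \<bar>c\<bar>)) ^ (n - 2) = (2 ^ n * B) ^ (n - 2) / of_int \<bar>c\<bar> ^ (n - 2)"
    by (simp add: power_divide)
  finally show "real (card (deg_two n N B c)) \<le> real (2 * N) * ((2 ^ n * B) ^ (n - 2) / of_int \<bar>c\<bar> ^ (n - 2))" .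
qed

text \<open>The exponent \<open>D - 2\<close> from \<alpha> and the exponent \<open>n - D\<close>
  from \<open>h\<close> add up to \<open>n - 2\<close> for every \<open>D\<close>.\<close>

lemma card_deg_large:
  assumes N: "N > 0" and D: "3 \<le> D" "D \<le> n" and B: "B \<ge> 1" and K: "K > 0"
    and ds: "\<And>e B. e \<le> n \<Longrightarrow> B \<ge> 1 \<Longrightarrow> finite (descent_set n N e B) \<and>
     real (card (descent_set n N e B)) \<le> K * B ^ e"
  shows "finite (deg_large n N B D)"
    "real (card (deg_large n N B D)) \<le> K * real N * (real n ^ n * 2 ^ n * B) ^ (n - 2)"
proof -
  define A where "A = descent_set n N (D - 2) (real n ^ n * B)"
  define U where "U = {u :: complex. u ^ N = 1}"
  define M where "M = monic_mahler (n - D) B"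
  define L where "L = real n ^ n * 2 ^ n * B"
  have n1: "1 \<le> real n ^ n" using D by (intro one_le_power) simp
  have nB: "1 \<le> real n ^ n * B" using mult_mono[OF n1 B] by simp
  have A: "finite A" "real (card A) \<le> K * (real n ^ n * B) ^ (D - 2)"
    using ds[of "D - 2" "real n ^ n * B"] D nB unfolding A_def by auto
  have U: "finite U" "card U \<le> N" unfolding U_def by (rule finite_card_roots_of_unity[OF N])+
  have M: "finite M" "real (card M) \<le> (2 ^ (n - D + 2) * B) ^ (n - D)"
    unfolding M_def by (rule finite_monic_mahler, rule card_monic_mahler[OF B])
  show "finite (deg_large n N B D)"
    unfolding deg_large_def A_def[symmetric] U_def[symmetric] M_def[symmetric] using A U M by auto
  have "card (deg_large n N B D) \<le> card (A \<times> U \<times> M)"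
    unfolding deg_large_def A_def[symmetric] U_def[symmetric] M_def[symmetric]
    using A U M by (intro card_image_le) auto
  also have "\<dots> = card A * (card U * card M)" by (simp add: card_cartesian_product)
  finally have "real (card (deg_large n N B D)) \<le> real (card A * (card U * card M))"
    by (simp only: of_nat_le_iff)
  also have "\<dots> = real (card A) * (real (card U) * real (card M))" by simp
  also have "\<dots> \<le> (K * L ^ (D - 2)) * (real N * L ^ (n - D))"
  proof (intro mult_mono)
    have "real n ^ n * 1 \<le> real n ^ n * 2 ^ n" by (intro mult_left_mono) auto
    then have "(real n ^ n * B) ^ (D - 2) \<le> L ^ (D - 2)"
      unfolding L_def using n1 B by (intro power_mono mult_right_mono) auto
    then have "K * (real n ^ n * B) ^ (D - 2) \<le> K * L ^ (D - 2)" using K by simp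
    then show "real (card A) \<le> K * L ^ (D - 2)" using A by linarith
    have "2 ^ (n - D + 2) * B \<le> 2 ^ n * B" using D B by (intro mult_right_mono power_increasing) auto
    also have "\<dots> \<le> real n ^ n * (2 ^ n * B)" using mult_right_mono[OF n1, of "2 ^ n * B"] B by simp
    finally have "2 ^ (n - D + 2) * B \<le> L" by (simp add: L_def mult.assoc)
    then have "(2 ^ (n - D + 2) * B) ^ (n - D) \<le> L ^ (n - D)" using B by (intro power_mono) auto
    then show "real (card M) \<le> L ^ (n - D)" using M by linarith
  qed (use U K B in \<open>auto simp: L_def\<close>)
  also have "\<dots> = K * real N * (L ^ (D - 2) * L ^ (n - D))" by (simp only: mult_ac)
  also have "L ^ (D - 2) * L ^ (n - D) = L ^ (n - 2)" using D by (simp flip: power_add)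
  finally show "real (card (deg_large n N B D)) \<le> K * real N * (real n ^ n * 2 ^ n * B) ^ (n - 2)"
    by (simp add: L_def)
qed

text \<open>The sum over the absolute value \<open>m\<close> of the constant term in the quadratic
  case is left explicit, because its growth is what separates \<open>n = 3\<close> from larger
  \<open>n\<close>.\<close>

lemma card_S_upper:
  assumes n: "n \<ge> 3"
  obtains K :: real where "K > 0" "\<And>H. H \<ge> 1 \<Longrightarrow> finite (S n H) \<and>
    real (card (S n H)) \<le> K * real H ^ (n - 2) * (1 + (\<Sum>m\<in>{1..(n + 1) * H}. 1 / real m ^ (n - 2)))"
proof -
  obtain N where N: "N > 0"
    "\<And>f \<alpha> \<beta> k. lead_coeff f = 1 \<Longrightarrow> degree f = n \<Longrightarrow> poly (ic f) \<alpha> = 0 \<Longrightarrow> poly (ic f) \<beta> = 0 \<Longrightarrow>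
       \<beta> \<noteq> 0 \<Longrightarrow> k > 0 \<Longrightarrow> (\<alpha> / \<beta>) ^ k = 1 \<Longrightarrow> \<alpha> ^ N = \<beta> ^ N"
    by (rule bounded_ratio_order[of n]) blast
  have n0: "n > 0" using n by simp
  obtain K where K: "K > 0" "\<And>e B. e \<le> n \<Longrightarrow> B \<ge> 1 \<Longrightarrow> finite (descent_set n N e B) \<and>
     real (card (descent_set n N e B)) \<le> K * B ^ e"
    by (rule descent_set_bound[OF N(1) n0]) blast
  define L where "L = real n ^ n * 2 ^ n"
  have n1: "1 \<le> real n ^ n" using n by (intro one_le_power) simp
  have L0: "L > 0" using n by (simp add: L_def)
  \<comment> \<open>At most \<open>n\<close> degrees \<open>D\<close> contribute
    \<open>K * real N\<close> each; the two signs of the constant term contribute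
    \<open>2 * N\<close> each.\<close>
  define K' where "K' = (L * real (n + 1)) ^ (n - 2) * (real n * (K * real N) + real (4 * N))"
  show ?thesis
  proof (rule that[of K'])
    show "K' > 0" unfolding K'_def using L0 K N by (intro mult_pos_pos zero_less_power add_pos_nonneg) (use n in auto)
    fix H :: nat assume H: "H \<ge> 1"
    define b where "b = (n + 1) * H"
    define T where "T = (\<Sum>m\<in>{1..b}. 1 / real m ^ (n - 2))"
    define X where "X = (\<Union>D\<in>{3..n}. deg_large n N (real b) D)"
    define Y where "Y = (\<Union>m\<in>{1..b}. deg_two n N (real b) (int m) \<union> deg_two n N (real b) (- int m))"
    define P where "P = (L * real b) ^ (n - 2)"
    have "b \<ge> 1" using H by (simp add: b_def)
    then have b1: "real b \<ge> 1" by simp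
    have P0: "P \<ge> 0" using L0 by (simp add: P_def)
    have T0: "T \<ge> 0" unfolding T_def by (intro sum_nonneg) simp
    have sub: "S n H \<subseteq> X \<union> Y" unfolding X_def Y_def b_def by (rule S_cover[OF N H])
    have XD: "finite (deg_large n N (real b) D)"
      "real (card (deg_large n N (real b) D)) \<le> K * real N * P" if "D \<in> {3..n}" for D
      using card_deg_large[OF N(1) _ _ b1 K, of D] that unfolding P_def L_def by auto
    have Ym: "finite (deg_two n N (real b) c)"
      "real (card (deg_two n N (real b) c)) \<le> real (2 * N) * (P / real m ^ (n - 2))"
      if "m \<in> {1..b}" "c = int m \<or> c = - int m" for m c
    proof -
      have n2: "n \<ge> 2" using n by simp
      have c: "0 < \<bar>c\<bar>" "of_int \<bar>c\<bar> \<le> real b" "of_int \<bar>c\<bar> = real m" using that by auto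
      show "finite (deg_two n N (real b) c)" by (rule card_deg_two[OF N(1) n2 c(1,2)])
      have "real (card (deg_two n N (real b) c)) \<le> real (2 * N) * ((2 ^ n * real b) ^ (n - 2) / real m ^ (n - 2))"
        using card_deg_two(2)[OF N(1) n2 c(1,2)] unfolding c(3) .
      also have "\<dots> \<le> real (2 * N) * (P / real m ^ (n - 2))"
      proof (intro mult_left_mono divide_right_mono)
        show "(2 ^ n * real b) ^ (n - 2) \<le> P"
          unfolding P_def L_def using mult_right_mono[OF n1, of "2 ^ n * real b"] by (intro power_mono) (auto simp: mult.assoc)
      qed auto
      finally show "real (card (deg_two n N (real b) c)) \<le> real (2 * N) * (P / real m ^ (n - 2))" .
    qed
    have finX: "finite X" unfolding X_def using XD(1) by blast
    have finY: "finite Y" unfolding Y_def using Ym(1) by blast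
    have "real (card X) \<le> (\<Sum>D\<in>{3..n}. real (card (deg_large n N (real b) D)))"
      unfolding X_def of_nat_sum[symmetric] of_nat_le_iff by (rule card_UN_le) simp
    also have "\<dots> \<le> (\<Sum>D\<in>{3..n}. K * real N * P)" by (rule sum_mono) (rule XD(2))
    also have "\<dots> = real (n - 2) * (K * real N * P)" using n by simp
    also have "\<dots> \<le> real n * (K * real N * P)" using K P0 by (intro mult_right_mono) auto
    finally have cX: "real (card X) \<le> real n * (K * real N) * P" by (simp only: mult_ac)
    have "real (card Y) \<le> (\<Sum>m\<in>{1..b}. real (card (deg_two n N (real b) (int m) \<union> deg_two n N (real b) (- int m))))"
      unfolding Y_def of_nat_sum[symmetric] of_nat_le_iff by (rule card_UN_le) simp
    also have "\<dots> \<le> (\<Sum>m\<in>{1..b}. real (4 * N) * P * (1 / real m ^ (n - 2)))"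
    proof (rule sum_mono)
      fix m assume m: "m \<in> {1..b}"
      have "real (card (deg_two n N (real b) (int m) \<union> deg_two n N (real b) (- int m)))
        \<le> real (card (deg_two n N (real b) (int m)) + card (deg_two n N (real b) (- int m)))"
        unfolding of_nat_le_iff by (rule card_Un_le)
      also have "\<dots> \<le> real (2 * N) * (P / real m ^ (n - 2)) + real (2 * N) * (P / real m ^ (n - 2))"
        unfolding of_nat_add by (intro add_mono Ym(2)[OF m]) auto
      also have "\<dots> = real (4 * N) * P * (1 / real m ^ (n - 2))" by simp
      finally show "real (card (deg_two n N (real b) (int m) \<union> deg_two n N (real b) (- int m)))
        \<le> real (4 * N) * P * (1 / real m ^ (n - 2))" .
    qed
    also have "\<dots> = real (4 * N) * P * T" unfolding T_def by (rule sum_distrib_left[symmetric])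
    finally have cY: "real (card Y) \<le> real (4 * N) * P * T" .
    have "real (card (S n H)) \<le> real (card X + card Y)"
      unfolding of_nat_le_iff using card_mono[OF _ sub] card_Un_le[of X Y] finX finY by (meson finite_UnI order_trans)
    also have "\<dots> \<le> real n * (K * real N) * P + real (4 * N) * P * T" using cX cY by simp
    also have "\<dots> \<le> (real n * (K * real N) + real (4 * N)) * P * (1 + T)"
    proof -
      have "0 \<le> real n * (K * real N) * P * T" "0 \<le> real (4 * N) * P"
        using K P0 T0 by auto
      then show ?thesis by (simp add: algebra_simps)
    qed
    also have "P = (L * real (n + 1)) ^ (n - 2) * real H ^ (n - 2)"
      unfolding P_def b_def by (simp only: of_nat_mult power_mult_distrib mult.assoc)
    also have "(real n * (K * real N) + real (4 * N)) * ((L * real (n + 1)) ^ (n - 2) * real H ^ (n - 2)) * (1 + T)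
      = K' * real H ^ (n - 2) * (1 + T)" unfolding K'_def by (simp only: mult_ac)
    finally show "finite (S n H) \<and>
      real (card (S n H)) \<le> K' * real H ^ (n - 2) * (1 + (\<Sum>m\<in>{1..(n + 1) * H}. 1 / real m ^ (n - 2)))"
      using finite_subset[OF sub] finX finY unfolding T_def b_def by blast
  qed
qed

lemma R_le_card_S: "finite (S n H) \<Longrightarrow> R n H \<le> card (S n H)"
  unfolding R_def by (rule card_mono) auto

section \<open>Bounds for sums of inverse powers\<close>

lemma sum_inverse_squares_le:
  assumes "n \<ge> 4" shows "(\<Sum>m\<in>{1..b}. 1 / real m ^ (n - 2)) \<le> 2"
proof -
  have sq: "(\<Sum>m\<in>{1..b}. 1 / real m ^ 2) \<le> 2 - 1 / real b" if "b \<ge> 1"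
    using that
  proof (induction b rule: nat_induct_at_least)
    case (Suc b)
    have "1 / real (Suc b) ^ 2 \<le> 1 / (real b * real (Suc b))"
      using Suc.hyps by (intro divide_left_mono) (auto simp: power2_eq_square)
    also have "\<dots> = 1 / real b - 1 / real (Suc b)" using Suc.hyps by (simp add: field_simps)
    finally show ?case using Suc.IH by simp
  qed simp
  have "(\<Sum>m\<in>{1..b}. 1 / real m ^ (n - 2)) \<le> (\<Sum>m\<in>{1..b}. 1 / real m ^ 2)"
    using assms by (intro sum_mono divide_left_mono power_increasing) auto
  also have "\<dots> \<le> 2"
  proof (cases "b \<ge> 1")
    case True
    have "1 / real b \<ge> 0" by simp
    then show ?thesis using sq[OF True] by linarith
  qed (simp add: not_le)
  finally show ?thesis .
qed

lemma harmonic_le: "b \<ge> 1 \<Longrightarrow> (\<Sum>m\<in>{1..b}. 1 / real m) \<le> 1 + ln (real b)"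
proof (induction b rule: nat_induct_at_least)
  case (Suc b)
  have "ln (real b / real (Suc b)) \<le> real b / real (Suc b) - 1"
    using Suc.hyps by (intro ln_le_minus_one) simp
  also have "\<dots> = - 1 / real (Suc b)" by (simp add: field_simps)
  finally have "1 / real (Suc b) \<le> ln (real (Suc b)) - ln (real b)"
    using Suc.hyps by (simp add: ln_div)
  then show ?case using Suc.IH by simp
qed simp

lemma harmonic_ge: "ln (real (Suc b)) \<le> (\<Sum>m\<in>{1..b}. 1 / real m)"
proof (induction b)
  case (Suc b)
  have "ln (real (Suc (Suc b)) / real (Suc b)) \<le> real (Suc (Suc b)) / real (Suc b) - 1"
    by (intro ln_le_minus_one) simp
  also have "\<dots> = 1 / real (Suc b)" by (simp add: field_simps)
  finally have "ln (real (Suc (Suc b))) - ln (real (Suc b)) \<le> 1 / real (Suc b)"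
    by (simp add: ln_div)
  then show ?case using Suc.IH by simp
qed simp

section \<open>Lower bounds and the quadratic case\<close>

lemma degree_0_if_unit: "(p :: 'a :: field poly) dvd 1 \<Longrightarrow> degree p = 0"
  using dvd_imp_degree_le[of p 1] by simp

lemma reducible_prodI:
  assumes "f = p * q" "degree p > 0" "degree q > 0"
  shows "reducible_over_Q f"
proof -
  have e: "ir f = ir p * ir q" by (simp add: assms of_int_poly_hom.hom_mult)
  have u: "\<not> ir p dvd 1" "\<not> ir q dvd 1"
    using assms(2,3) degree_0_if_unit[of "ir p"] degree_0_if_unit[of "ir q"] by auto
  have "p \<noteq> 0" "q \<noteq> 0" using assms by auto
  then have "ir f \<noteq> 0" by (simp add: assms)
  moreover have "\<not> ir f dvd 1" using e u(1) dvd_mult_left by metis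
  moreover have "\<not> irreducible (ir f)" using e u irreducibleD by metis
  ultimately show ?thesis by (simp add: reducible_over_Q_def)
qed

lemma degenerate_opposite_roots:
  assumes "poly p x = 0" "poly p (- x) = 0" "x \<noteq> 0" shows "degenerate p"
  unfolding degenerate_def
  using assms by (intro exI[of _ x] exI[of _ "- x"] conjI exI[of _ "2 :: nat"]) auto

lemma S_I:
  assumes "degree f = n" "lead_coeff f = 1" "\<And>k. k < n \<Longrightarrow> \<bar>poly.coeff f k\<bar> \<le> int H" "degenerate (ic f)"
  shows "f \<in> S n H"
  using assms by (auto simp: S_def)

lemma finite_S: "finite (S n H)"
proof (rule finite_subset)
  show "S n H \<subseteq> {g. lead_coeff g = 1 \<and> degree g = n \<and> (\<forall>k<n. \<bar>poly.coeff g k\<bar> \<le> int H)}"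
  proof
    fix f assume f: "f \<in> S n H"
    have lk: "\<bar>poly.coeff f k\<bar> \<le> int H" if "k < n" for k
    proof -
      have "n - k \<in> {1..n}" "n - (n - k) = k" using that by auto
      then show ?thesis using f unfolding S_def by (metis (no_types, lifting) mem_Collect_eq)
    qed
    then show "f \<in> {g. lead_coeff g = 1 \<and> degree g = n \<and> (\<forall>k<n. \<bar>poly.coeff g k\<bar> \<le> int H)}"
      using f lk unfolding S_def by blast
  qed
qed (rule monic_bounded_polys(1), simp)

lemma card_le_R:
  assumes "A \<subseteq> {f \<in> S n H. reducible_over_Q f}" shows "card A \<le> R n H"
  unfolding R_def by (rule card_mono[OF _ assms]) (simp add: finite_S)

lemma R_lower:
  assumes n: "n \<ge> 4" and H: "H \<ge> 2"
  shows "H ^ (n - 2) \<le> R n H"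
proof -
  \<comment> \<open>A coefficient of (X^2 + 1) g is a sum of at most two coefficients of g, so half
    of \<open>H\<close> is allowed for those below the leading one; rounding leaves 2 b + 1 \<ge> H
    choices for each.\<close>
  define b where "b = H div 2"
  define X where "X = {xs :: int list. set xs \<subseteq> {- int b..int b} \<and> length xs = n - 2}"
  define q where "q = [:1, 0, 1 :: int:]"
  define G where "G = (\<lambda>xs :: int list. Poly (xs @ [1]))"
  have cG: "coeffs (G xs) = xs @ [1]" for xs by (simp add: G_def)
  have degG: "degree (G xs) = length xs" for xs by (simp add: degree_eq_length_coeffs cG)
  have coG: "poly.coeff (G xs) j = (if j < length xs then xs ! j else if j = length xs then 1 else 0)" for xs j
    by (simp add: G_def nth_default_def nth_append)
  have inj: "inj_on (\<lambda>xs. q * G xs) X"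
  proof (rule inj_onI)
    fix xs ys assume "q * G xs = q * G ys"
    moreover have "q \<noteq> 0" by (simp add: q_def)
    ultimately have "G xs = G ys" by simp
    then have "xs @ [1] = ys @ [1]" using cG by metis
    then show "xs = ys" by simp
  qed
  have "(\<lambda>xs. q * G xs) ` X \<subseteq> {f \<in> S n H. reducible_over_Q f}"
  proof (rule image_subsetI)
    fix xs assume xs: "xs \<in> X"
    then have len: "length xs = n - 2" by (simp add: X_def)
    have G0: "G xs \<noteq> 0" using coG[of xs "length xs"] by auto
    have xb: "\<bar>xs ! j\<bar> \<le> int b" if "j < n - 2" for j
    proof -
      have "xs ! j \<in> set xs" using that len by simp
      then have "xs ! j \<in> {- int b..int b}" using xs unfolding X_def by blast
      then show ?thesis by (simp add: abs_le_iff)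
    qed
    have dq: "degree q = 2" by (simp add: q_def)
    have "degree (q * G xs) = n" using degree_mult_eq[of q "G xs"] G0 dq degG len n by (auto simp: q_def)
    moreover have "lead_coeff (q * G xs) = 1" unfolding lead_coeff_mult by (simp add: q_def coG degG)
    moreover have "\<bar>poly.coeff (q * G xs) k\<bar> \<le> int H" if k: "k < n" for k
    proof -
      have "q * G xs = G xs + pCons 0 (pCons 0 (G xs))" by (simp add: q_def)
      then have c: "poly.coeff (q * G xs) k = poly.coeff (G xs) k + (if k \<ge> 2 then poly.coeff (G xs) (k - 2) else 0)"
        by (auto simp: coeff_pCons split: nat.splits)
      have b2: "2 * int b \<le> int H" "int b + 1 \<le> int H" using H unfolding b_def by linarith+
      have "\<bar>poly.coeff (G xs) (k - 2)\<bar> \<le> int b" if "k \<ge> 2"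
        using xb[of "k - 2"] that k by (auto simp: coG len)
      moreover have "\<bar>poly.coeff (G xs) k\<bar> \<le> int b \<or> \<bar>poly.coeff (G xs) k\<bar> \<le> 1"
        using xb[of k] by (auto simp: coG len)
      moreover have "\<bar>poly.coeff (G xs) k\<bar> \<le> int H"
        using xb[of k] b2 by (auto simp: coG len)
      ultimately show ?thesis unfolding c using b2 by auto
    qed
    moreover have "degenerate (ic (q * G xs))"
    proof (rule degenerate_opposite_roots[of _ \<i>])
      have "poly (ic q) \<i> = 0" "poly (ic q) (- \<i>) = 0" by (simp_all add: q_def)
      then show "poly (ic (q * G xs)) \<i> = 0" "poly (ic (q * G xs)) (- \<i>) = 0"
        by (simp_all only: of_int_poly_hom.hom_mult poly_mult mult_zero_left)
    qed simp
    ultimately have "q * G xs \<in> S n H" by (rule S_I)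
    moreover have "reducible_over_Q (q * G xs)"
      by (rule reducible_prodI[OF refl]) (use n in \<open>simp_all add: dq degG len\<close>)
    ultimately show "q * G xs \<in> {f \<in> S n H. reducible_over_Q f}" by simp
  qed
  from card_le_R[OF this] have "card X \<le> R n H" by (simp add: card_image[OF inj])
  moreover have "card X = (2 * b + 1) ^ (n - 2)"
    unfolding X_def by (subst card_lists_length_eq) (auto simp: nat_add_distrib nat_mult_distrib)
  moreover have "H ^ (n - 2) \<le> (2 * b + 1) ^ (n - 2)" by (intro power_mono) (auto simp: b_def)
  ultimately show ?thesis by simp
qed

lemma R_3_lower:
  assumes H: "H \<ge> 2"
  shows "real H * ln (real H) / 2 \<le> real (R 3 H)"
proof -
  \<comment> \<open>For positive a and c, the product (X - a)(X^2 + c) has the coefficients -a, c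
    and -ac, so a c \<le> H is all that the height demands, and a and c can be read off.\<close>
  define P where "P = (SIGMA a:{1..H}. {1..H div a})"
  define F where "F = (\<lambda>(a, c). [:- (int a * int c), int c, - int a, 1:])"
  have inj: "inj_on F P" by (auto simp: inj_on_def F_def)
  have "F ` P \<subseteq> {f \<in> S 3 H. reducible_over_Q f}"
  proof (rule image_subsetI)
    fix p assume "p \<in> P"
    then obtain a c where p: "p = (a, c)" "1 \<le> a" "a \<le> H" "1 \<le> c" "c \<le> H div a" by (auto simp: P_def)
    have "c * a \<le> H" using p by (simp add: less_eq_div_iff_mult_less_eq)
    then have ac: "int a * int c \<le> int H" by (metis mult.commute of_nat_le_iff of_nat_mult)
    have cH: "c \<le> H" using p(5) div_le_dividend le_trans by blast
    have e: "F p = [:- int a, 1:] * [:int c, 0, 1:]" by (simp add: F_def p)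
    have "\<bar>poly.coeff (F p) k\<bar> \<le> int H" if "k < 3" for k
    proof -
      have "k = 0 \<or> k = 1 \<or> k = 2" using that by arith
      then consider "k = 0" | "k = 1" | "k = 2" by blast
      then show ?thesis by cases (use ac cH p in \<open>auto simp: F_def numeral_2_eq_2 abs_mult\<close>)
    qed
    moreover have "degenerate (ic (F p))"
    proof (rule degenerate_opposite_roots[of _ "\<i> * of_real (sqrt (real c))"])
      have "(\<i> * complex_of_real (sqrt (real c))) * (\<i> * of_real (sqrt (real c))) = - of_real (sqrt (real c) * sqrt (real c))"
        by (simp only: of_real_mult) (simp add: algebra_simps)
      also have "\<dots> = - of_nat c" by simp
      finally have sq: "(\<i> * complex_of_real (sqrt (real c))) * (\<i> * of_real (sqrt (real c))) = - of_nat c" .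
      have r: "poly (ic (F p)) x = (x - of_nat a) * (of_nat c + x * x)" for x
        unfolding e of_int_poly_hom.hom_mult by (simp add: algebra_simps)
      show "poly (ic (F p)) (\<i> * of_real (sqrt (real c))) = 0" unfolding r sq by simp
      show "poly (ic (F p)) (- (\<i> * of_real (sqrt (real c)))) = 0" unfolding r minus_mult_minus sq by simp
    qed (use p in auto)
    ultimately have "F p \<in> S 3 H" by (intro S_I) (auto simp: F_def p)
    moreover have "reducible_over_Q (F p)" by (rule reducible_prodI[OF e]) auto
    ultimately show "F p \<in> {f \<in> S 3 H. reducible_over_Q f}" by simp
  qed
  from card_le_R[OF this] have "card P \<le> R 3 H" by (simp add: card_image[OF inj])
  moreover have "card P = (\<Sum>a\<in>{1..H}. H div a)" unfolding P_def by (simp add: card_SigmaI)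
  ultimately have "(\<Sum>a\<in>{1..H}. H div a) \<le> R 3 H" by simp
  then have le: "real (\<Sum>a\<in>{1..H}. H div a) \<le> real (R 3 H)" by (simp only: of_nat_le_iff)
  have "real H * ln (real H) / 2 \<le> real H / 2 * ln (real (Suc H))"
    using H by (simp add: mult_left_mono)
  also have "\<dots> \<le> real H / 2 * (\<Sum>a\<in>{1..H}. 1 / real a)"
    by (intro mult_left_mono harmonic_ge) simp
  also have "\<dots> = (\<Sum>a\<in>{1..H}. real H / 2 * (1 / real a))" by (rule sum_distrib_left)
  also have "\<dots> \<le> (\<Sum>a\<in>{1..H}. real (H div a))"
  proof (rule sum_mono)
    fix a assume a: "a \<in> {1..H}"
    \<comment> \<open>Rounding \<open>H / a\<close> down loses at most a factor 2, since the
      quotient is at least 1.\<close>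
    have "H = a * (H div a) + H mod a" by simp
    moreover have "H mod a < a" using a by simp
    moreover have "1 \<le> H div a" using a by (simp add: div_greater_zero_iff Suc_le_eq)
    then have "a * 1 \<le> a * (H div a)" by (intro mult_left_mono) auto
    ultimately have "H \<le> 2 * (a * (H div a))" by linarith
    then have "real H \<le> 2 * (real a * real (H div a))" by (metis of_nat_le_iff of_nat_mult of_nat_numeral)
    then show "real H / 2 * (1 / real a) \<le> real (H div a)" using a by (simp add: field_simps)
  qed
  also have "\<dots> \<le> real (R 3 H)" using le by (simp only: of_nat_sum)
  finally show ?thesis .
qed

section \<open>The exact count in degree two\<close>

lemma linear_poly_eq:
  assumes "degree p = 1" shows "p = [:poly.coeff p 0, lead_coeff p:]"
proof (rule poly_eqI)
  fix k
  show "poly.coeff p k = poly.coeff [:poly.coeff p 0, lead_coeff p:] k"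
  proof (cases "k \<le> 1")
    case True
    then consider "k = 0" | "k = 1" by linarith
    then show ?thesis using assms by cases auto
  next
    case False
    then show ?thesis using assms coeff_eq_0[of p k] coeff_eq_0[of "[:poly.coeff p 0, lead_coeff p:]" k]
      degree_pCons_le[of "poly.coeff p 0" "[:lead_coeff p:]"] by simp
  qed
qed

text \<open>Gauss's lemma gives two integral linear factors, whose leading coefficients are the same
  sign \<open>u\<close>; moving \<open>u\<close> into the constant terms makes both monic.\<close>

lemma reducible_monic_quadratic:
  assumes f: "degree f = 2" "lead_coeff f = 1" and red: "reducible_over_Q f"
  obtains r s :: int where "f = [:- r, 1:] * [:- s, 1:]"
proof -
  have "\<not> irreducible (ir f)" using red by (simp add: reducible_over_Q_def Let_def)
  then have "\<not> irreducible\<^sub>d (ir f)" unfolding irreducible_connect_field .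
  then obtain a b where ab: "ir f = a * b" "degree a < 2" "degree b < 2"
    using f(1) unfolding irreducible\<^sub>d_def by auto
  from rat_to_int_factor[OF ab(1)] obtain p q
    where pq: "f = p * q" "degree p = degree a" "degree q = degree b" by auto
  have "degree p + degree q = 2" 
  proof -
    have "p \<noteq> 0" "q \<noteq> 0" using f(1) pq(1) by auto
    then show ?thesis using degree_mult_eq[of p q] f(1) pq(1) by simp
  qed
  then have d: "degree p = 1" "degree q = 1" using ab pq by auto
  define u where "u = lead_coeff p"
  have "u * lead_coeff q = 1" using f(2) pq(1) by (simp add: lead_coeff_mult u_def)
  then have u: "u * u = 1" "lead_coeff q = u" using zmult_eq_1_iff by force+
  define p0 q0 where "p0 = poly.coeff p 0" and "q0 = poly.coeff q 0"
  have p: "p = [:p0, u:]" and q: "q = [:q0, u:]"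
    using linear_poly_eq[OF d(1)] linear_poly_eq[OF d(2)] u(2) by (simp_all add: p0_def q0_def u_def)
  have "f = [:- (- (u * p0)), 1:] * [:- (- (u * q0)), 1:]"
    using u(1) unfolding pq(1) p q by (simp add: algebra_simps)
  then show ?thesis by (rule that)
qed

text \<open>The roots are integers whose quotient has modulus 1; being distinct, they are opposite,
  and the polynomial is X^2 - r^2.\<close>

lemma R_2_set:
  "{f \<in> S 2 H. reducible_over_Q f} = (\<lambda>r. [:- (int r ^ 2), 0, 1:]) ` {r. 1 \<le> r \<and> r\<^sup>2 \<le> H}"
proof (intro equalityI subsetI)
  fix f assume "f \<in> {f \<in> S 2 H. reducible_over_Q f}"
  then have fS: "f \<in> S 2 H" and red: "reducible_over_Q f" by auto
  have f: "degree f = 2" "lead_coeff f = 1" "degenerate (ic f)" using fS by (auto simp: S_def)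
  obtain r s where rs: "f = [:- r, 1:] * [:- s, 1:]" using reducible_monic_quadratic[OF f(1,2) red] .
  have pf: "poly (ic f) x = (x - of_int r) * (x - of_int s)" for x
    unfolding rs of_int_poly_hom.hom_mult by (simp add: algebra_simps)
  obtain \<alpha> \<beta> k where *: "poly (ic f) \<alpha> = 0" "poly (ic f) \<beta> = 0" "\<alpha> \<noteq> \<beta>" "\<alpha> \<noteq> 0" "\<beta> \<noteq> 0"
    "k > (0::nat)" "(\<alpha> / \<beta>) ^ k = 1"
    using degenerate_normal_form[OF f(2,3)] by blast
  have "cmod (\<alpha> / \<beta>) ^ k = 1" using *(7) by (metis norm_one norm_power)
  then have "cmod (\<alpha> / \<beta>) = 1" using power_eq_iff_eq_base[of k "cmod (\<alpha> / \<beta>)" 1] *(6) by simp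
  then have nn: "cmod \<alpha> = cmod \<beta>" using *(5) by (simp add: norm_divide field_simps)
  have "(\<alpha> = of_int r \<and> \<beta> = of_int s) \<or> (\<alpha> = of_int s \<and> \<beta> = of_int r)" using *(1,2,3) unfolding pf by auto
  then have "\<bar>r\<bar> = \<bar>s\<bar>" "r \<noteq> s" "r \<noteq> 0" using nn *(3-5) by auto
  then have s: "s = - r" "r \<noteq> 0" by auto
  have fr: "f = [:- (int (nat \<bar>r\<bar>) ^ 2), 0, 1:]" unfolding rs s(1) by (simp add: power2_eq_square)
  have "\<forall>j\<in>{1..2}. \<bar>poly.coeff f (2 - j)\<bar> \<le> int H" using fS unfolding S_def by blast
  from bspec[OF this, of 2] have "\<bar>poly.coeff f (2 - 2)\<bar> \<le> int H" by simp
  then have "int (nat \<bar>r\<bar>) ^ 2 \<le> int H" unfolding fr by simp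
  then have "int ((nat \<bar>r\<bar>)\<^sup>2) \<le> int H" by simp
  then have "(nat \<bar>r\<bar>)\<^sup>2 \<le> H" by (simp only: of_nat_le_iff)
  then show "f \<in> (\<lambda>r. [:- (int r ^ 2), 0, 1:]) ` {r. 1 \<le> r \<and> r\<^sup>2 \<le> H}"
    using fr s(2) by (intro image_eqI[where x = "nat \<bar>r\<bar>"]) auto
next
  fix f assume "f \<in> (\<lambda>r. [:- (int r ^ 2), 0, 1:]) ` {r. 1 \<le> r \<and> r\<^sup>2 \<le> H}"
  then obtain r where r: "1 \<le> r" "r\<^sup>2 \<le> H" and f: "f = [:- (int r ^ 2), 0, 1:]" by blast
  have rH: "int r ^ 2 \<le> int H" using r(2) by simp
  have e: "f = [:- int r, 1:] * [:int r, 1:]" by (simp add: f power2_eq_square)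
  have "\<bar>poly.coeff f k\<bar> \<le> int H" if "k < 2" for k
  proof -
    have "k = 0 \<or> k = 1" using that by arith
    then show ?thesis using rH by (auto simp: f)
  qed
  moreover have "degenerate (ic f)"
    by (rule degenerate_opposite_roots[of _ "of_nat r"]) (use r in \<open>simp_all add: f power2_eq_square\<close>)
  ultimately have "f \<in> S 2 H" by (intro S_I) (auto simp: f)
  moreover have "reducible_over_Q f" by (rule reducible_prodI[OF e]) auto
  ultimately show "f \<in> {f \<in> S 2 H. reducible_over_Q f}" by simp
qed

lemma R_2: "int (R 2 H) = \<lfloor>sqrt (real H)\<rfloor>"
proof -
  define k where "k = nat \<lfloor>sqrt (real H)\<rfloor>"
  have iff: "r\<^sup>2 \<le> H \<longleftrightarrow> r \<le> k" for r
  proof -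
    have "r\<^sup>2 \<le> H \<longleftrightarrow> real (r\<^sup>2) \<le> real H" by (simp only: of_nat_le_iff)
    also have "\<dots> \<longleftrightarrow> sqrt (real (r\<^sup>2)) \<le> sqrt (real H)" by (simp only: real_sqrt_le_iff)
    also have "sqrt (real (r\<^sup>2)) = real r" by simp
    also have "real r \<le> sqrt (real H) \<longleftrightarrow> r \<le> k" by (simp add: k_def le_nat_iff le_floor_iff)
    finally show ?thesis .
  qed
  have set: "{r. 1 \<le> r \<and> r\<^sup>2 \<le> H} = {1..k}" unfolding iff by auto
  have inj: "inj_on (\<lambda>r :: nat. [:- (int r ^ 2), 0, 1:]) {1..k}"
  proof (rule inj_onI)
    fix r s :: nat assume "[:- (int r ^ 2), 0, 1:] = [:- (int s ^ 2), 0, 1:]"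
    then have "int r ^ 2 = int s ^ 2" by simp
    then show "r = s" by (simp add: power2_eq_iff_nonneg)
  qed
  have "R 2 H = k" unfolding R_def R_2_set set card_image[OF inj] by simp
  then show ?thesis by (simp add: k_def)
qed

lemma R_upper:
  assumes n: "n \<ge> 4"
  shows "\<exists>C>0. \<forall>H\<ge>2. real (R n H) \<le> C * real H ^ (n - 2)"
proof -
  have n3: "n \<ge> 3" using n by simp
  obtain K :: real where K: "K > 0" "\<And>H. H \<ge> 1 \<Longrightarrow> finite (S n H) \<and>
    real (card (S n H)) \<le> K * real H ^ (n - 2) * (1 + (\<Sum>m\<in>{1..(n + 1) * H}. 1 / real m ^ (n - 2)))"
    by (rule card_S_upper[OF n3]) blast
  have "real (R n H) \<le> (3 * K) * real H ^ (n - 2)" if H: "H \<ge> 2" for H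
  proof -
    have "real (R n H) \<le> real (card (S n H))" using R_le_card_S[OF finite_S] by simp
    also have "\<dots> \<le> K * real H ^ (n - 2) * (1 + (\<Sum>m\<in>{1..(n + 1) * H}. 1 / real m ^ (n - 2)))"
      using K(2)[of H] H by auto
    also have "\<dots> \<le> K * real H ^ (n - 2) * (1 + 2)"
      using K(1) sum_inverse_squares_le[OF n] by (intro mult_left_mono add_left_mono) auto
    finally show ?thesis by simp
  qed
  then show ?thesis using K(1) by (intro exI[of _ "3 * K"]) auto
qed

lemma R_3_upper: "\<exists>C>0. \<forall>H\<ge>2. real (R 3 H) \<le> C * real H * ln (real H)"
proof -
  obtain K :: real where K: "K > 0" "\<And>H. H \<ge> 1 \<Longrightarrow> finite (S 3 H) \<and>
    real (card (S 3 H)) \<le> K * real H ^ (3 - 2) * (1 + (\<Sum>m\<in>{1..(3 + 1) * H}. 1 / real m ^ (3 - 2)))"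
    by (rule card_S_upper[of 3, OF order.refl]) blast
  \<comment> \<open>The constant part of 1 + (1 + ln (4 H)). As ln H \<ge> ln 2 > 0, it is absorbed
    into a multiple of ln H with factor \<open>c / ln 2\<close>.\<close>
  define c where "c = 2 + ln (4 :: real)"
  have c0: "c \<ge> 0" by (simp add: c_def)
  have l2: "ln 2 > (0::real)" by simp
  have "real (R 3 H) \<le> (K * (c / ln 2 + 1)) * real H * ln (real H)" if H: "H \<ge> 2" for H
  proof -
    have "real (R 3 H) \<le> real (card (S 3 H))" using R_le_card_S[OF finite_S] by simp
    also have "\<dots> \<le> K * real H * (1 + (\<Sum>m\<in>{1..4 * H}. 1 / real m))"
      using K(2)[of H] H by (auto simp: numeral_eq_Suc)
    also have "\<dots> \<le> K * real H * (1 + (1 + ln (real (4 * H))))"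
      using K(1) H harmonic_le[of "4 * H"] by (intro mult_left_mono add_left_mono) auto
    also have "1 + (1 + ln (real (4 * H))) = c + ln (real H)" using H by (simp add: c_def ln_mult)
    also have "K * real H * (c + ln (real H)) \<le> K * real H * ((c / ln 2 + 1) * ln (real H))"
    proof (rule mult_left_mono)
      have "ln 2 \<le> ln (real H)" using H by simp
      then have "c / ln 2 * ln 2 \<le> c / ln 2 * ln (real H)" using c0 l2 by (intro mult_left_mono) auto
      then have "c \<le> c / ln 2 * ln (real H)" using l2 by simp
      then show "c + ln (real H) \<le> (c / ln 2 + 1) * ln (real H)" by (simp add: algebra_simps)
    qed (use K(1) in simp)
    finally show ?thesis by (simp add: mult_ac)
  qed
  moreover have "K * (c / ln 2 + 1) > 0" using K(1) c0 l2 by (intro mult_pos_pos add_nonneg_pos) auto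
  ultimately show ?thesis by blast
qed

theorem theorem1p3:
  shows "(\<forall>H\<ge>2. int (R 2 H) = \<lfloor>sqrt (real H)\<rfloor>) \<and>
         (\<exists>c C :: real. c > 0 \<and> C > 0 \<and>
            (\<forall>H\<ge>2. c * real H * ln (real H) \<le> real (R 3 H) \<and>
                   real (R 3 H) \<le> C * real H * ln (real H))) \<and>
         (\<forall>n\<ge>4. \<exists>c C :: real. c > 0 \<and> C > 0 \<and>
            (\<forall>H\<ge>2. c * real H ^ (n - 2) \<le> real (R n H) \<and>
                   real (R n H) \<le> C * real H ^ (n - 2)))"
proof (intro conjI allI impI)
  fix H :: nat assume "H \<ge> 2"
  show "int (R 2 H) = \<lfloor>sqrt (real H)\<rfloor>" by (rule R_2)
next
  obtain C :: real where C: "C > 0" "\<forall>H\<ge>2. real (R 3 H) \<le> C * real H * ln (real H)"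
    using R_3_upper by blast
  have "1 / 2 * real H * ln (real H) \<le> real (R 3 H)" if "H \<ge> 2" for H
    using R_3_lower[OF that] by simp
  with C show "\<exists>c C :: real. c > 0 \<and> C > 0 \<and>
      (\<forall>H\<ge>2. c * real H * ln (real H) \<le> real (R 3 H) \<and> real (R 3 H) \<le> C * real H * ln (real H))"
    by (intro exI[of _ "1 / 2"] exI[of _ C]) auto
next
  fix n :: nat assume n: "n \<ge> 4"
  obtain C :: real where C: "C > 0" "\<forall>H\<ge>2. real (R n H) \<le> C * real H ^ (n - 2)"
    using R_upper[OF n] by blast
  have "1 * real H ^ (n - 2) \<le> real (R n H)" if "H \<ge> 2" for H
  proof -
    have "real (H ^ (n - 2)) \<le> real (R n H)" unfolding of_nat_le_iff by (rule R_lower[OF n that])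
    then show ?thesis by simp
  qed
  with C show "\<exists>c C :: real. c > 0 \<and> C > 0 \<and>
      (\<forall>H\<ge>2. c * real H ^ (n - 2) \<le> real (R n H) \<and> real (R n H) \<le> C * real H ^ (n - 2))"
    by (intro exI[of _ 1] exI[of _ C]) auto
qed

end
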